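(* Let $K=(k_{\alpha\beta})_{1\le\alpha,\beta\le n}\in C^{r+1}(\overline{\mathcal{T}})^{n\times n}$ be any solution to the kernel equations $$\begin{cases}\Lambda(x)\dfrac{\partial K}{\partial x}(x,\xi)+\dfrac{\partial K}{\partial\xi}(x,\xi)\Lambda(\xi)+K(x,\xi)\big(\Lambda'(\xi)+M^0(\xi)\big)=0,\\[2mm] \Lambda(x)K(x,x)-K(x,x)\Lambda(x)=M^0(x),\end{cases}$$ where $\mathcal{T}=\{(x,\xi)\in\mathbb{R}^2: 0<\xi<x<1\}$. Then $$k_{\alpha\beta}(0,0)=\frac{m^0_{\alpha\beta}(0)}{\lambda_\alpha(0)-\lambda_\beta(0)}\qquad(\beta\ne\alpha),$$ and, for every $1\le\alpha,\beta\le n$ and $1\le N\le r+1$, $$J^{(N)}_{\alpha\beta}\,(D^Nk_{\alpha\beta})(0,0)=\Phi^{(N)}_{\alpha\beta}\big(K_\alpha(0,0),\ldots,(D^{N-1}K_\alpha)(0,0)\big),$$ where the matrix $J^{(N)}_{\alpha\beta}\in\mathbb{R}^{(N+1)\times(N+1)}$ and the map $\Phi^{(N)}_{\alpha\beta}:\mathbb{R}^{1\times n}\times\cdots\times\mathbb{R}^{N\times n}\to\mathbb{R}^{N+1}$ are the explicit ones given in the context, and $J^{(N)}_{\alpha\beta}$ is invertible.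
   Context: Let $m,p\ge1$, $n=m+p$, $r\in\mathbb{N}=\{0,1,\dots\}$. $\Lambda=\mathrm{diag}(\lambda_1,\ldots,\lambda_n)$ and $M=(m_{\alpha\beta})$ belong to $C^{r+1}([0,1])^{n\times n}$, with $\lambda_1(x)<\cdots<\lambda_m(x)<0<\lambda_{m+1}(x)<\cdots<\lambda_{m+p}(x)$ for all $x\in[0,1]$. Set $D(x)=\mathrm{diag}\big(e^{-\int_0^x m_{kk}(\xi)/\lambda_k(\xi)\,d\xi}\big)_{1\le k\le n}$ and $$M^0(x)=(m^0_{\alpha\beta}(x))=\big(D(x)M(x)+\Lambda(x)D'(x)\big)D(x)^{-1}\in C^{r+1}([0,1])^{n\times n},$$ whose diagonal entries are all zero. $K_\alpha$ is the $\alpha$-th row of $K$. For a smooth enough (scalar or matrix-valued) function $h$ on $\overline{\mathcal{T}}$ and $N\in\mathbb{N}$, $D^Nh$ is the column (of blocks) $\big(\frac{\partial^Nh}{\partial x^N},\frac{\partial^Nh}{\partial x^{N-1}\partial\xi},\ldots,\frac{\partial^Nh}{\partial\xi^N}\big)^{\mathsf T}$, stacked vertically; so $(D^jK_\alpha)(0,0)\in\mathbb{R}^{(j+1)\times n}$. Definition of $J^{(N)}_{\alpha\beta}$. For $1\le l\le N$, the $l$-th row of $J^{(N)}_{\alpha\beta}$ has entry $\lambda_\alpha(0)$ in column $l$, entry $\lambda_\beta(0)$ in column $l+1$, and zeros elsewhere. Its last row (row $N+1$) is $\big(\binom N0,\binom N1,\ldots,\binom NN\big)$ if $\beta\ne\alpha$,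 and $(1,0,\ldots,0)$ if $\beta=\alpha$. Definition of $\Phi^{(N)}_{\alpha\beta}$. Put $A=\Lambda'+M^0$; $f_{\alpha\beta}(x)=\frac{m^0_{\alpha\beta}(x)}{\lambda_\alpha(x)-\lambda_\beta(x)}$ for $\beta\ne\alpha$, $f_{\alpha\alpha}(x)=k_{\alpha\alpha}(x,0)$; $F_\alpha=(f_{\alpha1},\ldots,f_{\alpha n})$. Then $\Phi^{(N)}_{\alpha\beta}$ is the $\beta$-th column of the $(N+1)\times n$ matrix $$\Phi^{(N)}_\alpha=\begin{pmatrix}\bar\Phi^{(N)}_\alpha\\ F_\alpha^{(N)}(0)\end{pmatrix},$$ where $$\bar\Phi^{(N)}_\alpha=-\sum_{\sigma=0}^{N-1}R^{(N)}_\sigma(D^{N-1-\sigma}K_\alpha)(0,0)A^{(\sigma)}(0)-\sum_{\sigma=1}^{N-1}\lambda_\alpha^{(\sigma)}(0)\check S^{(N)}_\sigma(D^{N-\sigma}K_\alpha)(0,0)-\sum_{\sigma=1}^{N-1}S^{(N)}_\sigma(D^{N-\sigma}K_\alpha)(0,0)\Lambda^{(\sigma)}(0).$$ Here $E^{(N)}_\sigma=\mathrm{diag}\big(\binom i\sigma\big)_{\sigma\le i\le N-1}$ and $\check E^{(N)}_\sigma=\mathrm{diag}\big(\binom{N-i}\sigma\big)_{1\le i\le N-\sigma}$ are $(N-\sigma)\times(N-\sigma)$ matrices, $R^{(N)}_0=E^{(N)}_0$, and for $1\le\sigma\le N-1$ $$R^{(N)}_\sigma=\begin{pmatrix}0 \\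 E^{(N)}_\sigma\end{pmatrix}\in\mathbb{R}^{N\times(N-\sigma)},\quad \check S^{(N)}_\sigma=\begin{pmatrix}\check E^{(N)}_\sigma&0\\0&0\end{pmatrix}\in\mathbb{R}^{N\times(N-\sigma+1)},\quad S^{(N)}_\sigma=\begin{pmatrix}0&0\\0&E^{(N)}_\sigma\end{pmatrix}\in\mathbb{R}^{N\times(N-\sigma+1)}.$$ *)

theory Defs
  imports "HOL-Analysis.Analysis" "Jordan_Normal_Form.Gauss_Jordan_Elimination"
begin

text \<open>
  Matrices are those of Jordan_Normal_Form, whose rows and columns are numbered from 0.  The
  indices \<open>1, \<dots>, n\<close> of the mathematical text are therefore \<open>0, \<dots>, n - 1\<close> here, and the first
  \<open>m\<close> of the \<open>\<lambda>\<^sub>k\<close> are those with \<open>k < m\<close>.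
\<close>

text \<open>The derivative on \<open>[0,1]\<close>, one-sided at the end points.\<close>

definition deriv01 :: "(real \<Rightarrow> real) \<Rightarrow> real \<Rightarrow> real" where
  "deriv01 f x = vector_derivative f (at x within {0..1})"

primrec C01 :: "nat \<Rightarrow> (real \<Rightarrow> real) \<Rightarrow> bool" where
  "C01 0 f \<longleftrightarrow> continuous_on {0..1} f"
| "C01 (Suc k) f \<longleftrightarrow> f differentiable_on {0..1} \<and> C01 k (deriv01 f)"

definition mderiv01 :: "(real \<Rightarrow> real mat) \<Rightarrow> real \<Rightarrow> real mat" where
  "mderiv01 F x = Matrix.mat (dim_row (F x)) (dim_col (F x))
     (\<lambda>(i, j). deriv01 (\<lambda>t. F t $$ (i, j)) x)"

definition C01_mat :: "nat \<Rightarrow> nat \<Rightarrow> (real \<Rightarrow> real mat) \<Rightarrow> bool" where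
  "C01_mat n k F \<longleftrightarrow> (\<forall>x\<in>{0..1}. F x \<in> carrier_mat n n) \<and>
     (\<forall>i<n. \<forall>j<n. C01 k (\<lambda>x. F x $$ (i, j)))"

definition tri :: "(real \<times> real) set" where
  "tri = {(x, \<xi>). 0 < \<xi> \<and> \<xi> < x \<and> x < 1}"

text \<open>
  A function is \<open>C\<^sup>k\<close> on the closure of the open triangle if it is continuous there, has continuous
  partial derivatives up to order \<open>k\<close> in the open triangle, and these extend continuously to
  the closure.  Accordingly a partial derivative at a boundary point is the limit of the
  partial derivative from inside.  (A one-sided difference quotient would not do: at \<open>(0,0)\<close> the
  vertical line meets the closed triangle in a single point.)
\<close>

definition extend_tri :: "(real \<times> real \<Rightarrow> real) \<Rightarrow> real \<times> real \<Rightarrow> real" where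
  "extend_tri g z = (if z \<in> tri then g z else Lim (at z within tri) g)"

definition pdx :: "(real \<times> real \<Rightarrow> real) \<Rightarrow> real \<times> real \<Rightarrow> real" where
  "pdx h = extend_tri (\<lambda>(x, \<xi>). deriv (\<lambda>t. h (t, \<xi>)) x)"

definition pdxi :: "(real \<times> real \<Rightarrow> real) \<Rightarrow> real \<times> real \<Rightarrow> real" where
  "pdxi h = extend_tri (\<lambda>(x, \<xi>). deriv (\<lambda>t. h (x, t)) \<xi>)"

primrec Ctri :: "nat \<Rightarrow> (real \<times> real \<Rightarrow> real) \<Rightarrow> bool" where
  "Ctri 0 h \<longleftrightarrow> continuous_on (closure tri) h"
| "Ctri (Suc k) h \<longleftrightarrow> continuous_on (closure tri) h \<and>
     (\<forall>(x, \<xi>)\<in>tri. (\<lambda>t. h (t, \<xi>)) differentiable (at x) \<and> (\<lambda>t. h (x, t)) differentiable (at \<xi>)) \<and>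
     Ctri k (pdx h) \<and> Ctri k (pdxi h)"

definition Ctri_mat :: "nat \<Rightarrow> nat \<Rightarrow> (real \<times> real \<Rightarrow> real mat) \<Rightarrow> bool" where
  "Ctri_mat n k K \<longleftrightarrow> (\<forall>z\<in>closure tri. K z \<in> carrier_mat n n) \<and>
     (\<forall>i<n. \<forall>j<n. Ctri k (\<lambda>z. K z $$ (i, j)))"

definition mpdx :: "(real \<times> real \<Rightarrow> real mat) \<Rightarrow> real \<times> real \<Rightarrow> real mat" where
  "mpdx K z = Matrix.mat (dim_row (K z)) (dim_col (K z)) (\<lambda>(i, j). pdx (\<lambda>w. K w $$ (i, j)) z)"

definition mpdxi :: "(real \<times> real \<Rightarrow> real mat) \<Rightarrow> real \<times> real \<Rightarrow> real mat" where
  "mpdxi K z = Matrix.mat (dim_row (K z)) (dim_col (K z)) (\<lambda>(i, j). pdxi (\<lambda>w. K w $$ (i, j)) z)"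

text \<open>Entry \<open>i\<close> of \<open>D\<^sup>N h\<close> is differentiated \<open>N - i\<close> times in \<open>x\<close> and \<open>i\<close> times in \<open>\<xi>\<close>.\<close>

definition pd :: "nat \<Rightarrow> nat \<Rightarrow> (real \<times> real \<Rightarrow> real) \<Rightarrow> real \<times> real \<Rightarrow> real" where
  "pd N i h = (pdx ^^ (N - i)) ((pdxi ^^ i) h)"

definition Dvec :: "nat \<Rightarrow> (real \<times> real \<Rightarrow> real) \<Rightarrow> real \<times> real \<Rightarrow> real Matrix.vec" where
  "Dvec N h z = Matrix.vec (N + 1) (\<lambda>i. pd N i h z)"

definition Drow :: "nat \<Rightarrow> nat \<Rightarrow> (real \<times> real \<Rightarrow> real mat) \<Rightarrow> nat \<Rightarrow> real \<times> real \<Rightarrow> real mat" where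
  "Drow n N K \<alpha> z = Matrix.mat (N + 1) n (\<lambda>(i, \<beta>). pd N i (\<lambda>w. K w $$ (\<alpha>, \<beta>)) z)"

definition Lam :: "nat \<Rightarrow> (nat \<Rightarrow> real \<Rightarrow> real) \<Rightarrow> real \<Rightarrow> real mat" where
  "Lam n lam x = mat_diag n (\<lambda>k. lam k x)"

definition Dmat :: "nat \<Rightarrow> (nat \<Rightarrow> real \<Rightarrow> real) \<Rightarrow> (real \<Rightarrow> real mat) \<Rightarrow> real \<Rightarrow> real mat" where
  "Dmat n lam M x =
     mat_diag n (\<lambda>k. exp (- integral {0..x} (\<lambda>\<xi>. M \<xi> $$ (k, k) / lam k \<xi>)))"

definition M0 :: "nat \<Rightarrow> (nat \<Rightarrow> real \<Rightarrow> real) \<Rightarrow> (real \<Rightarrow> real mat) \<Rightarrow> real \<Rightarrow> real mat" where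
  "M0 n lam M x =
     (Dmat n lam M x * M x + Lam n lam x * mderiv01 (Dmat n lam M) x) *
       the (mat_inverse (Dmat n lam M x))"

definition Acoef :: "nat \<Rightarrow> (nat \<Rightarrow> real \<Rightarrow> real) \<Rightarrow> (real \<Rightarrow> real mat) \<Rightarrow> real \<Rightarrow> real mat" where
  "Acoef n lam M x = mderiv01 (Lam n lam) x + M0 n lam M x"

definition Jmat :: "(nat \<Rightarrow> real \<Rightarrow> real) \<Rightarrow> nat \<Rightarrow> nat \<Rightarrow> nat \<Rightarrow> real mat" where
  "Jmat lam N \<alpha> \<beta> = Matrix.mat (N + 1) (N + 1) (\<lambda>(l, j).
     if l < N then (if j = l then lam \<alpha> 0 else if j = l + 1 then lam \<beta> 0 else 0)
     else if \<beta> \<noteq> \<alpha> then real (N choose j)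
     else if j = 0 then 1 else 0)"

definition Emat :: "nat \<Rightarrow> nat \<Rightarrow> real mat" where
  "Emat N \<sigma> = mat_diag (N - \<sigma>) (\<lambda>i. real ((\<sigma> + i) choose \<sigma>))"

definition Echeck :: "nat \<Rightarrow> nat \<Rightarrow> real mat" where
  "Echeck N \<sigma> = mat_diag (N - \<sigma>) (\<lambda>i. real ((N - (i + 1)) choose \<sigma>))"

definition Rmat :: "nat \<Rightarrow> nat \<Rightarrow> real mat" where
  "Rmat N \<sigma> = (if \<sigma> = 0 then Emat N 0 else 0\<^sub>m \<sigma> (N - \<sigma>) @\<^sub>r Emat N \<sigma>)"

definition Scheck :: "nat \<Rightarrow> nat \<Rightarrow> real mat" where
  "Scheck N \<sigma> =
     four_block_mat (Echeck N \<sigma>) (0\<^sub>m (N - \<sigma>) 1) (0\<^sub>m \<sigma> (N - \<sigma>)) (0\<^sub>m \<sigma> 1)"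

definition Smat :: "nat \<Rightarrow> nat \<Rightarrow> real mat" where
  "Smat N \<sigma> =
     four_block_mat (0\<^sub>m \<sigma> 1) (0\<^sub>m \<sigma> (N - \<sigma>)) (0\<^sub>m (N - \<sigma>) 1) (Emat N \<sigma>)"

text \<open>The type of matrices of all sizes has no zero, so \<open>sum\<close> does not apply to it.\<close>

definition msum :: "nat \<Rightarrow> nat \<Rightarrow> (nat \<Rightarrow> real mat) \<Rightarrow> nat set \<Rightarrow> real mat" where
  "msum nr nc B I = Matrix.mat nr nc (\<lambda>ij. \<Sum>\<sigma>\<in>I. B \<sigma> $$ ij)"

text \<open>
  In the following, \<open>X j\<close> is the argument of \<open>\<Phi>\<close> in \<open>\<real>\<^bsup>(j+1)\<times>n\<^esup>\<close>; only \<open>X 0, \<dots>, X (N - 1)\<close> are used.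
  The function \<open>f\<close> is the diagonal entry \<open>f\<^sub>\<alpha>\<^sub>\<alpha>\<close> of \<open>F\<^sub>\<alpha>\<close>, which \<open>\<Phi>\<close> contains as a datum.
\<close>

definition Phibar ::
  "nat \<Rightarrow> (nat \<Rightarrow> real \<Rightarrow> real) \<Rightarrow> (real \<Rightarrow> real mat) \<Rightarrow> nat \<Rightarrow> nat \<Rightarrow> (nat \<Rightarrow> real mat) \<Rightarrow> real mat"
where
  "Phibar n lam M N \<alpha> X =
     - msum N n (\<lambda>\<sigma>. Rmat N \<sigma> * X (N - 1 - \<sigma>) * (mderiv01 ^^ \<sigma>) (Acoef n lam M) 0) {0..<N}
     - msum N n (\<lambda>\<sigma>. (deriv01 ^^ \<sigma>) (lam \<alpha>) 0 \<cdot>\<^sub>m (Scheck N \<sigma> * X (N - \<sigma>))) {1..<N}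
     - msum N n (\<lambda>\<sigma>. Smat N \<sigma> * X (N - \<sigma>) * (mderiv01 ^^ \<sigma>) (Lam n lam) 0) {1..<N}"

definition Frow ::
  "nat \<Rightarrow> (nat \<Rightarrow> real \<Rightarrow> real) \<Rightarrow> (real \<Rightarrow> real mat) \<Rightarrow> nat \<Rightarrow> (real \<Rightarrow> real) \<Rightarrow> real \<Rightarrow> real mat"
where
  "Frow n lam M \<alpha> f x = Matrix.mat 1 n (\<lambda>(_, \<beta>).
     if \<beta> \<noteq> \<alpha> then M0 n lam M x $$ (\<alpha>, \<beta>) / (lam \<alpha> x - lam \<beta> x) else f x)"

definition Phi ::
  "nat \<Rightarrow> (nat \<Rightarrow> real \<Rightarrow> real) \<Rightarrow> (real \<Rightarrow> real mat) \<Rightarrow> (real \<Rightarrow> real) \<Rightarrow> nat \<Rightarrow> nat \<Rightarrow> nat \<Rightarrow>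
    (nat \<Rightarrow> real mat) \<Rightarrow> real Matrix.vec"
where
  "Phi n lam M f N \<alpha> \<beta> X =
     col (Phibar n lam M N \<alpha> X @\<^sub>r (mderiv01 ^^ N) (Frow n lam M \<alpha> f) 0) \<beta>"

definition kernel_solution ::
  "nat \<Rightarrow> (nat \<Rightarrow> real \<Rightarrow> real) \<Rightarrow> (real \<Rightarrow> real mat) \<Rightarrow> (real \<times> real \<Rightarrow> real mat) \<Rightarrow> bool"
where
  "kernel_solution n lam M K \<longleftrightarrow>
     (\<forall>(x, \<xi>)\<in>tri.
        Lam n lam x * mpdx K (x, \<xi>) + mpdxi K (x, \<xi>) * Lam n lam \<xi> +
        K (x, \<xi>) * (mderiv01 (Lam n lam) \<xi> + M0 n lam M \<xi>) = 0\<^sub>m n n) \<and>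
     (\<forall>x\<in>{0..1}. Lam n lam x * K (x, x) - K (x, x) * Lam n lam x = M0 n lam M x)"

end

theory Submission
  imports Defs "Jordan_Normal_Form.Determinant"
begin

text \<open>
  Write \<open>k\<^sub>\<alpha>\<^sub>\<beta>\<close> for the entries of \<open>K\<close>.  In row \<open>\<alpha>\<close> and column \<open>\<beta>\<close> the kernel equations say
  \<open>\<lambda>\<^sub>\<alpha>(x) \<partial>\<^sub>x k\<^sub>\<alpha>\<^sub>\<beta> + \<lambda>\<^sub>\<beta>(\<xi>) \<partial>\<^sub>\<xi> k\<^sub>\<alpha>\<^sub>\<beta> + (terms without derivatives) = 0\<close>.  Differentiating \<open>N - 1 - l\<close> times in
  \<open>x\<close> and \<open>l\<close> times in \<open>\<xi>\<close> and evaluating at \<open>(0,0)\<close> gives, for \<open>l = 0, \<dots>, N - 1\<close>, one linear equation for the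
  \<open>N + 1\<close> derivatives of order \<open>N\<close>: the leading terms \<open>\<lambda>\<^sub>\<alpha>(0) \<partial>\<^sub>x\<^bsup>N-l\<^esup>\<partial>\<^sub>\<xi>\<^bsup>l\<^esup> k + \<lambda>\<^sub>\<beta>(0) \<partial>\<^sub>x\<^bsup>N-l-1\<^esup>\<partial>\<^sub>\<xi>\<^bsup>l+1\<^esup> k\<close> form row
  \<open>l\<close> of \<open>J\<close>, and the other terms of the Leibniz rule are the entries of \<open>\<Phi>\<close>
  (lemmas \<open>differentiated_kernel_equation\<close> and \<open>Phibar_index\<close>).
  The missing equation comes from a side of the triangle.  If \<open>\<beta> \<noteq> \<alpha>\<close>, the algebraic equation fixes
  \<open>k\<^sub>\<alpha>\<^sub>\<beta>(x,x) = m\<^sup>0\<^sub>\<alpha>\<^sub>\<beta>(x) / (\<lambda>\<^sub>\<alpha>(x) - \<lambda>\<^sub>\<beta>(x))\<close>, and the \<open>N\<close>-th derivative of the left-hand side is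
  \<open>(\<partial>\<^sub>x + \<partial>\<^sub>\<xi>)\<^sup>N k\<^sub>\<alpha>\<^sub>\<beta>\<close>; this also gives the value at \<open>(0,0)\<close>.  If \<open>\<beta> = \<alpha>\<close>, the \<open>N\<close>-th derivative of
  \<open>k\<^sub>\<alpha>\<^sub>\<alpha>(x,0)\<close> is the datum.  The matrix \<open>J\<close> is invertible because its first \<open>N\<close> rows only admit geometric null
  vectors, which the last row excludes (lemma \<open>invertible_Jmat\<close>).

  The analytic content is that these computations are legitimate at the boundary, where the partial
  derivatives are limits from inside the triangle.  Sums, products and the commutation of \<open>\<partial>\<^sub>x\<close> with
  \<open>\<partial>\<^sub>\<xi>\<close> pass from the open triangle to its closure by continuity.  Derivatives along the sides are different,
  since a side contains no inner point: there lemma \<open>has_derivative_closure_tri\<close> shows that a \<open>C\<^sup>1\<close> function has a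
  total derivative relative to the closed triangle, and the chain rule applies.
\<close>

section \<open>The closed triangle\<close>

lemma tri_eq: "tri = {z. 0 < snd z} \<inter> {z. snd z < fst z} \<inter> {z. fst z < 1}"
  by (auto simp: tri_def)

lemma tri_bounds: "(x, y) \<in> tri \<Longrightarrow> 0 < x \<and> x < 1 \<and> 0 < y \<and> y < 1"
  by (auto simp: tri_def)

lemma open_tri: "open tri"
  unfolding tri_eq by (intro open_Int open_Collect_less continuous_intros)

lemma convex_tri: "convex tri"
proof -
  have "tri = {z. inner (0, 1) z > 0} \<inter> {z. inner (1, -1) z > 0} \<inter> {z. inner (1, 0) z < (1::real)}"
    by (auto simp: tri_def)
  moreover have "convex \<dots>"
    by (intro convex_Int convex_halfspace_gt convex_halfspace_lt)
  ultimately show ?thesis by metis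
qed

lemma closure_tri: "closure tri = {(x, y). 0 \<le> y \<and> y \<le> x \<and> x \<le> 1}"
proof
  have "closed {z::real \<times> real. 0 \<le> snd z \<and> snd z \<le> fst z \<and> fst z \<le> 1}"
    by (intro closed_Collect_conj closed_Collect_le continuous_intros)
  moreover have "tri \<subseteq> {z. 0 \<le> snd z \<and> snd z \<le> fst z \<and> fst z \<le> 1}"
    by (auto simp: tri_def)
  ultimately have "closure tri \<subseteq> {z. 0 \<le> snd z \<and> snd z \<le> fst z \<and> fst z \<le> 1}"
    by (rule closure_minimal[rotated])
  then show "closure tri \<subseteq> {(x, y). 0 \<le> y \<and> y \<le> x \<and> x \<le> 1}"
    by auto
next
  show "{(x, y). 0 \<le> y \<and> y \<le> x \<and> x \<le> 1} \<subseteq> closure tri"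
  proof
    fix z :: "real \<times> real"
    assume z: "z \<in> {(x, y). 0 \<le> y \<and> y \<le> x \<and> x \<le> 1}"
    obtain x y where xy: "z = (x, y)" by (cases z)
    define s where "s k = 1 / real (Suc k)" for k
    \<comment> \<open>The segment from \<open>z\<close> to the inner point \<open>(2/3, 1/3)\<close> lies in the open triangle except perhaps for \<open>z\<close>.\<close>
    define w where "w k = (x + s k * (2/3 - x), y + s k * (1/3 - y))" for k
    have s: "0 < s k" "s k \<le> 1" for k by (auto simp: s_def)
    have "w k \<in> tri" for k
    proof -
      have "(1 - s k) * y \<ge> 0" "(1 - s k) * (x - y) \<ge> 0" "(1 - s k) * (1 - x) \<ge> 0"
        using s[of k] z xy by auto
      then show ?thesis
        using s(1)[of k] by (auto simp: w_def tri_def algebra_simps)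
    qed
    moreover have "w \<longlonglongrightarrow> (x + 0 * (2/3 - x), y + 0 * (1/3 - y))"
      unfolding w_def s_def using LIMSEQ_inverse_real_of_nat
      by (intro tendsto_intros) (simp_all add: inverse_eq_divide)
    ultimately show "z \<in> closure tri"
      unfolding xy closure_sequential by auto
  qed
qed

lemma tri_subset_closure: "z \<in> tri \<Longrightarrow> z \<in> closure tri"
  using closure_subset by blast

lemma closure_tri_islimpt: assumes "z \<in> closure tri" shows "z islimpt tri"
proof (cases "z \<in> tri")
  case True
  then show ?thesis using open_tri by (simp add: interior_open interior_limit_point)
next
  case False
  with assms show ?thesis by (simp add: closure_def)
qed

lemma closure_tri_nontrivial: "z \<in> closure tri \<Longrightarrow> at z within tri \<noteq> bot"
  using closure_tri_islimpt by (simp add: trivial_limit_within)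

text \<open>
  Every identity between continuous functions is proved in the open triangle, where the partial
  derivatives are honest ones, and carried to the corner and the sides by continuity.
\<close>

lemma eq_on_closure_tri:
  fixes f g :: "real \<times> real \<Rightarrow> real"
  assumes "continuous_on (closure tri) f" "continuous_on (closure tri) g"
    and "\<And>z. z \<in> tri \<Longrightarrow> f z = g z" and z: "z \<in> closure tri"
  shows "f z = g z"
proof -
  have "continuous_on (closure tri) (\<lambda>z. f z - g z)"
    using assms by (intro continuous_intros)
  then show ?thesis
    using continuous_constant_on_closure[of tri "\<lambda>z. f z - g z" 0 z] assms by auto
qed

section \<open>Partial derivatives on the closed triangle\<close>

text \<open>
  The extension by limits only sees the values in the open triangle: at a boundary point the limit is
  taken within the triangle, and far away from it every number is a limit, whatever the function.
  So functions that agree in the triangle have extensions that agree on the whole plane.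
\<close>

lemma extend_tri_cong:
  assumes "\<And>z. z \<in> tri \<Longrightarrow> g z = g' z" shows "extend_tri g = extend_tri g'"
proof
  fix z
  have "eventually (\<lambda>w. g w = g' w) (at z within tri)"
    using assms by (auto simp: eventually_at_filter)
  then have "(g \<longlongrightarrow> l) (at z within tri) = (g' \<longlongrightarrow> l) (at z within tri)" for l
    by (rule tendsto_cong)
  then show "extend_tri g z = extend_tri g' z"
    using assms by (simp add: extend_tri_def t2_space_class.Lim_def)
qed

lemma extend_tri_eq:
  assumes "continuous_on (closure tri) f" and "\<And>z. z \<in> tri \<Longrightarrow> g z = f z"
    and z: "z \<in> closure tri"
  shows "extend_tri g z = f z"
proof (cases "z \<in> tri")
  case True
  then show ?thesis by (simp add: extend_tri_def assms)
next
  case False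
  have "(f \<longlongrightarrow> f z) (at z within closure tri)"
    using assms(1) z by (simp add: continuous_on_def)
  then have "(f \<longlongrightarrow> f z) (at z within tri)"
    by (rule tendsto_within_subset) (rule closure_subset)
  then have "Lim (at z within tri) f = f z"
    by (intro tendsto_Lim closure_tri_nontrivial z)
  moreover have "extend_tri g z = extend_tri f z"
    by (subst extend_tri_cong[of g f]) (auto simp: assms)
  ultimately show ?thesis using False by (simp add: extend_tri_def)
qed

lemma tri_sections:
  assumes "(x, y) \<in> tri"
  shows "eventually (\<lambda>t. (t, y) \<in> tri) (nhds x)" "eventually (\<lambda>t. (x, t) \<in> tri) (nhds y)"
proof -
  have "open ((\<lambda>t. (t, y)) -` tri)" "open ((\<lambda>t. (x, t)) -` tri)"
    by (auto intro!: open_vimage open_tri continuous_intros)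
  then show "eventually (\<lambda>t. (t, y) \<in> tri) (nhds x)" "eventually (\<lambda>t. (x, t) \<in> tri) (nhds y)"
    unfolding eventually_nhds using assms by blast+
qed

lemma pdx_cong: assumes "\<And>z. z \<in> tri \<Longrightarrow> h z = h' z" shows "pdx h = pdx h'"
  unfolding pdx_def
proof (rule extend_tri_cong, clarsimp)
  fix x y assume "(x, y) \<in> tri"
  then have "eventually (\<lambda>t. h (t, y) = h' (t, y)) (nhds x)"
    by (auto intro: eventually_mono[OF tri_sections(1)] assms)
  then show "deriv (\<lambda>t. h (t, y)) x = deriv (\<lambda>t. h' (t, y)) x"
    by (rule deriv_cong_ev) simp
qed

lemma pdxi_cong: assumes "\<And>z. z \<in> tri \<Longrightarrow> h z = h' z" shows "pdxi h = pdxi h'"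
  unfolding pdxi_def
proof (rule extend_tri_cong, clarsimp)
  fix x y assume "(x, y) \<in> tri"
  then have "eventually (\<lambda>t. h (x, t) = h' (x, t)) (nhds y)"
    by (auto intro: eventually_mono[OF tri_sections(2)] assms)
  then show "deriv (\<lambda>t. h (x, t)) y = deriv (\<lambda>t. h' (x, t)) y"
    by (rule deriv_cong_ev) simp
qed

text \<open>
  The way all partial derivatives are computed: a continuous function on the closed triangle that is
  the partial derivative inside is also its extension to the boundary.
\<close>

lemma pdx_eqI:
  assumes "continuous_on (closure tri) g"
    and "\<And>x y. (x, y) \<in> tri \<Longrightarrow> ((\<lambda>t. h (t, y)) has_real_derivative g (x, y)) (at x)"
    and "z \<in> closure tri"
  shows "pdx h z = g z"
  unfolding pdx_def
  by (rule extend_tri_eq) (use assms in \<open>auto intro!: DERIV_imp_deriv\<close>)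

lemma pdxi_eqI:
  assumes "continuous_on (closure tri) g"
    and "\<And>x y. (x, y) \<in> tri \<Longrightarrow> ((\<lambda>t. h (x, t)) has_real_derivative g (x, y)) (at y)"
    and "z \<in> closure tri"
  shows "pdxi h z = g z"
  unfolding pdxi_def
  by (rule extend_tri_eq) (use assms in \<open>auto intro!: DERIV_imp_deriv\<close>)

lemma Ctri_cong:
  assumes "\<And>z. z \<in> closure tri \<Longrightarrow> h z = h' z"
  shows "Ctri k h \<longleftrightarrow> Ctri k h'"
proof -
  have c: "continuous_on (closure tri) h \<longleftrightarrow> continuous_on (closure tri) h'"
    using assms by (intro continuous_on_cong) auto
  have e: "pdx h = pdx h'" "pdxi h = pdxi h'"
    by (auto intro!: pdx_cong pdxi_cong assms tri_subset_closure)
  have "(\<lambda>t. h (t, y)) differentiable (at x) \<longleftrightarrow> (\<lambda>t. h' (t, y)) differentiable (at x)"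
    if "(x, y) \<in> tri" for x y
  proof -
    have "eventually (\<lambda>t. h (t, y) = h' (t, y)) (nhds x)"
      using tri_sections(1)[OF that] by eventually_elim (auto intro: assms tri_subset_closure)
    then show ?thesis unfolding real_differentiable_def by (simp add: DERIV_cong_ev[OF refl _ refl])
  qed
  moreover have "(\<lambda>t. h (x, t)) differentiable (at y) \<longleftrightarrow> (\<lambda>t. h' (x, t)) differentiable (at y)"
    if "(x, y) \<in> tri" for x y
  proof -
    have "eventually (\<lambda>t. h (x, t) = h' (x, t)) (nhds y)"
      using tri_sections(2)[OF that] by eventually_elim (auto intro: assms tri_subset_closure)
    then show ?thesis unfolding real_differentiable_def by (simp add: DERIV_cong_ev[OF refl _ refl])
  qed
  ultimately show ?thesis
    by (cases k) (auto simp: c e)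
qed

lemma Ctri_continuous: "Ctri k h \<Longrightarrow> continuous_on (closure tri) h"
  by (cases k) auto

lemma Ctri_SucD: "Ctri (Suc k) h \<Longrightarrow> Ctri k h"
proof (induction k arbitrary: h)
  case (Suc k)
  note p = Suc.prems[unfolded Ctri.simps(2)[of "Suc k"]]
  show ?case unfolding Ctri.simps(2)[of k] using p Suc.IH by blast
qed simp

text \<open>
  Unfolding these recursions automatically would put higher and higher derivatives into every goal.
\<close>

declare Ctri.simps(2) [simp del] C01.simps(2) [simp del]

lemma Ctri_Suc_pdx: "Ctri (Suc k) h \<Longrightarrow> Ctri k (pdx h)"
  and Ctri_Suc_pdxi: "Ctri (Suc k) h \<Longrightarrow> Ctri k (pdxi h)"
  by (simp_all add: Ctri.simps(2))

lemma Ctri_mono: "Ctri k h \<Longrightarrow> j \<le> k \<Longrightarrow> Ctri j h"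
  by (induction k) (auto simp: le_Suc_eq dest: Ctri_SucD)

lemma Ctri_has_derivative_sections:
  assumes "Ctri (Suc k) h" "(x, y) \<in> tri"
  shows "((\<lambda>t. h (t, y)) has_real_derivative pdx h (x, y)) (at x)"
    and "((\<lambda>t. h (x, t)) has_real_derivative pdxi h (x, y)) (at y)"
proof -
  have "(\<lambda>t. h (t, y)) differentiable (at x)" "(\<lambda>t. h (x, t)) differentiable (at y)"
    using assms by (auto simp: Ctri.simps(2))
  then show "((\<lambda>t. h (t, y)) has_real_derivative pdx h (x, y)) (at x)"
    and "((\<lambda>t. h (x, t)) has_real_derivative pdxi h (x, y)) (at y)"
    using assms(2)
    by (auto simp: pdx_def pdxi_def extend_tri_def DERIV_deriv_iff_real_differentiable)
qed

text \<open>
  Recognising \<open>C\<^sup>k\<^sup>+\<^sup>1\<close> functions without mentioning limits: it is enough to exhibit \<open>C\<^sup>k\<close> functions on the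
  closed triangle that are the partial derivatives inside.
\<close>

lemma CtriI:
  assumes "continuous_on (closure tri) h" "Ctri k g" "Ctri k g'"
    and "\<And>x y. (x, y) \<in> tri \<Longrightarrow> ((\<lambda>t. h (t, y)) has_real_derivative g (x, y)) (at x)"
    and "\<And>x y. (x, y) \<in> tri \<Longrightarrow> ((\<lambda>t. h (x, t)) has_real_derivative g' (x, y)) (at y)"
  shows "Ctri (Suc k) h"
proof -
  have "Ctri k (pdx h)"
    by (subst Ctri_cong[of _ g]) (auto intro!: pdx_eqI assms Ctri_continuous[OF assms(2)])
  moreover have "Ctri k (pdxi h)"
    by (subst Ctri_cong[of _ g']) (auto intro!: pdxi_eqI assms Ctri_continuous[OF assms(3)])
  ultimately show ?thesis
    using assms(1,4,5) by (auto simp: Ctri.simps(2) real_differentiable_def, blast+)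
qed

lemma pdx_add:
  assumes "Ctri (Suc k) f" "Ctri (Suc k) g" "z \<in> closure tri"
  shows "pdx (\<lambda>z. f z + g z) z = pdx f z + pdx g z"
  using assms by (intro pdx_eqI) 
    (auto intro!: continuous_intros derivative_intros Ctri_has_derivative_sections intro: Ctri_continuous Ctri_continuous[OF Ctri_Suc_pdx] Ctri_continuous[OF Ctri_Suc_pdxi])

lemma pdxi_add:
  assumes "Ctri (Suc k) f" "Ctri (Suc k) g" "z \<in> closure tri"
  shows "pdxi (\<lambda>z. f z + g z) z = pdxi f z + pdxi g z"
  using assms by (intro pdxi_eqI) 
    (auto intro!: continuous_intros derivative_intros Ctri_has_derivative_sections intro: Ctri_continuous Ctri_continuous[OF Ctri_Suc_pdx] Ctri_continuous[OF Ctri_Suc_pdxi])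

lemma Ctri_add: "Ctri k f \<Longrightarrow> Ctri k g \<Longrightarrow> Ctri k (\<lambda>z. f z + g z)"
proof (induction k arbitrary: f g)
  case 0
  then show ?case by (auto intro: continuous_intros)
next
  case (Suc k)
  show ?case
  proof (rule CtriI)
    show "Ctri k (\<lambda>z. pdx f z + pdx g z)" "Ctri k (\<lambda>z. pdxi f z + pdxi g z)"
      using Suc by (auto intro: Ctri_Suc_pdx Ctri_Suc_pdxi)
  qed (use Suc.prems in \<open>auto intro!: continuous_intros derivative_intros Ctri_has_derivative_sections intro: Ctri_continuous Ctri_continuous[OF Ctri_Suc_pdx] Ctri_continuous[OF Ctri_Suc_pdxi]\<close>)
qed

lemma pdx_mult:
  assumes "Ctri (Suc k) f" "Ctri (Suc k) g" "z \<in> closure tri"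
  shows "pdx (\<lambda>z. f z * g z) z = pdx f z * g z + f z * pdx g z"
  using assms by (intro pdx_eqI) 
    (auto intro!: continuous_intros derivative_eq_intros Ctri_has_derivative_sections intro: Ctri_continuous Ctri_continuous[OF Ctri_Suc_pdx] Ctri_continuous[OF Ctri_Suc_pdxi])

lemma pdxi_mult:
  assumes "Ctri (Suc k) f" "Ctri (Suc k) g" "z \<in> closure tri"
  shows "pdxi (\<lambda>z. f z * g z) z = pdxi f z * g z + f z * pdxi g z"
  using assms by (intro pdxi_eqI) 
    (auto intro!: continuous_intros derivative_eq_intros Ctri_has_derivative_sections intro: Ctri_continuous Ctri_continuous[OF Ctri_Suc_pdx] Ctri_continuous[OF Ctri_Suc_pdxi])

lemma Ctri_mult: "Ctri k f \<Longrightarrow> Ctri k g \<Longrightarrow> Ctri k (\<lambda>z. f z * g z)"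
proof (induction k arbitrary: f g)
  case 0
  then show ?case by (auto intro: continuous_intros)
next
  case (Suc k)
  show ?case
  proof (rule CtriI)
    show "Ctri k (\<lambda>z. pdx f z * g z + f z * pdx g z)" "Ctri k (\<lambda>z. pdxi f z * g z + f z * pdxi g z)"
      using Suc by (auto intro!: Ctri_add intro: Ctri_Suc_pdx Ctri_Suc_pdxi Ctri_SucD)
  qed (use Suc.prems in \<open>auto intro!: continuous_intros derivative_eq_intros Ctri_has_derivative_sections intro: Ctri_continuous Ctri_continuous[OF Ctri_Suc_pdx] Ctri_continuous[OF Ctri_Suc_pdxi]\<close>)
qed

lemma Ctri_const: "Ctri k (\<lambda>_. c)"
proof (induction k arbitrary: c)
  case (Suc k)
  show ?case by (rule CtriI[OF _ Suc[of 0] Suc[of 0]]) auto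
qed auto

lemma pdx_const: "z \<in> closure tri \<Longrightarrow> pdx (\<lambda>_. c) z = 0"
  by (rule pdx_eqI) auto

lemma pdxi_const: "z \<in> closure tri \<Longrightarrow> pdxi (\<lambda>_. c) z = 0"
  by (rule pdxi_eqI) auto

section \<open>Functions of one variable on the triangle\<close>

lemma C01_continuous: "C01 k f \<Longrightarrow> continuous_on {0..1} f"
  by (cases k) (auto simp: C01.simps(2) intro: differentiable_imp_continuous_on)

lemma C01_SucD: "C01 (Suc k) f \<Longrightarrow> C01 k f"
proof (induction k arbitrary: f)
  case (Suc k)
  then show ?case unfolding C01.simps(2) by blast
qed (auto simp: C01.simps(2) intro: differentiable_imp_continuous_on)

lemma C01_Suc_deriv01: "C01 (Suc k) f \<Longrightarrow> C01 k (deriv01 f)"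
  by (simp add: C01.simps(2))

lemma C01_mono: "C01 k h \<Longrightarrow> j \<le> k \<Longrightarrow> C01 j h"
  by (induction k) (auto simp: le_Suc_eq dest: C01_SucD)

lemma C01_has_vector_derivative:
  assumes "C01 (Suc k) f" "x \<in> {0..1}"
  shows "(f has_vector_derivative deriv01 f x) (at x within {0..1})"
  using assms by (auto simp: C01.simps(2) deriv01_def vector_derivative_works[symmetric] differentiable_on_def)

lemma C01_has_real_derivative:
  assumes "C01 (Suc k) f" "x \<in> {0..1}"
  shows "(f has_real_derivative deriv01 f x) (at x within {0..1})"
  using C01_has_vector_derivative[OF assms] by (simp add: has_real_derivative_iff_has_vector_derivative)

lemma C01_has_real_derivative_interior:
  assumes "C01 (Suc k) f" "0 < x" "x < 1"
  shows "(f has_real_derivative deriv01 f x) (at x)"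
  using C01_has_real_derivative[OF assms(1), of x] assms(2,3) by (simp add: at_within_Icc_at)

lemma deriv01_eqI:
  assumes "(f has_real_derivative D) (at x within {0..1})" "x \<in> {0..1}"
  shows "deriv01 f x = D"
  unfolding deriv01_def
  by (rule vector_derivative_within_cbox[of 0 1, simplified])
     (use assms in \<open>auto simp: has_real_derivative_iff_has_vector_derivative\<close>)

lemma continuous_on_fst_C01:
  "C01 k g \<Longrightarrow> continuous_on (closure tri) (\<lambda>z. g (fst z))"
  by (rule continuous_on_compose2[OF C01_continuous]) (auto simp: closure_tri intro!: continuous_intros)

lemma continuous_on_snd_C01:
  "C01 k g \<Longrightarrow> continuous_on (closure tri) (\<lambda>z. g (snd z))"
  by (rule continuous_on_compose2[OF C01_continuous]) (auto simp: closure_tri intro!: continuous_intros)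

lemma Ctri_fst: "C01 k g \<Longrightarrow> Ctri k (\<lambda>z. g (fst z))"
proof (induction k arbitrary: g)
  case 0
  then show ?case using continuous_on_fst_C01[of 0] by simp
next
  case (Suc k)
  show ?case
    by (rule CtriI[OF _ _ Ctri_const[of k 0], where g = "\<lambda>z. deriv01 g (fst z)"])
       (use Suc in \<open>auto intro!: C01_Suc_deriv01 continuous_on_fst_C01[OF Suc.prems] C01_has_real_derivative_interior[OF Suc.prems] dest: tri_bounds\<close>)
qed

lemma Ctri_snd: "C01 k g \<Longrightarrow> Ctri k (\<lambda>z. g (snd z))"
proof (induction k arbitrary: g)
  case 0
  then show ?case using continuous_on_snd_C01[of 0] by simp
next
  case (Suc k)
  show ?case
    by (rule CtriI[OF _ Ctri_const[of k 0], where g' = "\<lambda>z. deriv01 g (snd z)"])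
       (use Suc in \<open>auto intro!: C01_Suc_deriv01 continuous_on_snd_C01[OF Suc.prems] C01_has_real_derivative_interior[OF Suc.prems] dest: tri_bounds\<close>)
qed

lemma pdx_fst: "C01 (Suc k) g \<Longrightarrow> z \<in> closure tri \<Longrightarrow> pdx (\<lambda>z. g (fst z)) z = deriv01 g (fst z)"
  by (rule pdx_eqI) (auto intro!: continuous_on_fst_C01[of k] C01_has_real_derivative_interior[of k] C01_Suc_deriv01 dest: tri_bounds)

lemma pdxi_fst: "z \<in> closure tri \<Longrightarrow> pdxi (\<lambda>z. g (fst z)) z = 0"
  by (rule pdxi_eqI) auto

lemma pdxi_snd: "C01 (Suc k) g \<Longrightarrow> z \<in> closure tri \<Longrightarrow> pdxi (\<lambda>z. g (snd z)) z = deriv01 g (snd z)"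
  by (rule pdxi_eqI) (auto intro!: continuous_on_snd_C01[of k] C01_has_real_derivative_interior[of k] C01_Suc_deriv01 dest: tri_bounds)

lemma pdx_snd: "z \<in> closure tri \<Longrightarrow> pdx (\<lambda>z. g (snd z)) z = 0"
  by (rule pdx_eqI) auto

section \<open>Total derivative up to the boundary and symmetry of second derivatives\<close>

text \<open>
  Continuous partial derivatives give total differentiability.  The triangle is not a rectangle, so the
  criterion is applied on a small rectangle around the point.
\<close>

lemma has_derivative_tri:
  assumes h: "Ctri (Suc k) h" and z: "z \<in> tri"
  shows "(h has_derivative (\<lambda>v. fst v * pdx h z + snd v * pdxi h z)) (at z)"
proof -
  obtain x y where xy: "z = (x, y)" by (cases z)
  obtain X0 Y0 where XY0: "open X0" "open Y0" "x \<in> X0" "y \<in> Y0" "X0 \<times> Y0 \<subseteq> tri"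
    using open_tri z unfolding xy open_prod_def by fast
  obtain e where e: "e > 0" "ball y e \<subseteq> Y0"
    using XY0 open_contains_ball by blast
  define Y where "Y = ball y e"
  have sub: "X0 \<times> Y \<subseteq> tri" using XY0 e by (auto simp: Y_def)
  have "((\<lambda>(x, y). h (x, y)) has_derivative
      (\<lambda>(tx, ty). tx * pdx h (x, y) + blinfun_mult_left (pdxi h (x, y)) ty)) (at (x, y) within X0 \<times> Y)"
  proof (rule has_derivative_partialsI)
    show "((\<lambda>x. h (x, y)) has_derivative (\<lambda>tx. tx * pdx h (x, y))) (at x within X0)"
      unfolding mult_commute_abs
      using Ctri_has_derivative_sections(1)[OF h z[unfolded xy], unfolded has_field_derivative_def]
      by (rule has_derivative_at_withinI)
    show "((\<lambda>y. h (x', y)) has_derivative blinfun_apply (blinfun_mult_left (pdxi h (x', y'))))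
        (at y' within Y)" if "x' \<in> X0" "y' \<in> Y" for x' y'
    proof -
      have "(x', y') \<in> tri" using sub that by blast
      from Ctri_has_derivative_sections(2)[OF h this] show ?thesis
        unfolding blinfun_mult_left.rep_eq mult_commute_abs has_field_derivative_def
        by (rule has_derivative_at_withinI)
    qed
    have "continuous_on (X0 \<times> Y) (\<lambda>z. blinfun_mult_left (pdxi h z))"
      using Ctri_continuous[OF Ctri_Suc_pdxi[OF h]] sub closure_subset
      by (intro bounded_linear.continuous_on[OF bounded_linear_blinfun_mult_left])
        (auto intro: continuous_on_subset)
    then show "continuous (at (x, y) within X0 \<times> Y) (\<lambda>(x, y). blinfun_mult_left (pdxi h (x, y)))"
      using XY0 e by (auto simp: continuous_on_eq_continuous_within Y_def split_def)
  qed (use e in \<open>auto simp: Y_def\<close>)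
  moreover have "at (x, y) within X0 \<times> Y = at (x, y)"
    using XY0 e by (intro at_within_open) (auto simp: Y_def open_Times)
  ultimately show ?thesis by (simp add: xy split_def)
qed

text \<open>
  The limits from inside are the coefficients of a total derivative along the closed triangle, also at
  the boundary, and even at the corner \<open>(0,0)\<close>.  The reason is that the triangle is convex: near \<open>z\<close> the
  differential varies by less than \<open>e\<close>, so the mean value inequality bounds the linearisation
  error of any two inner points, uniformly, and both points may then move to the boundary.
\<close>

lemma has_derivative_closure_tri:
  assumes h: "Ctri (Suc k) h" and z: "z \<in> closure tri"
  shows "(h has_derivative (\<lambda>v. fst v * pdx h z + snd v * pdxi h z)) (at z within closure tri)"
proof -
  define L where "L w v = fst v * pdx h w + snd v * pdxi h w" for w v
  have bl: "bounded_linear (L w)" for w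
    unfolding L_def by (intro bounded_linear_intros)
  have bl_diff: "L w (u - v) = L w u - L w v" for w u v
    by (simp add: L_def algebra_simps)
  note c = Ctri_continuous[OF h] Ctri_continuous[OF Ctri_Suc_pdx[OF h]] Ctri_continuous[OF Ctri_Suc_pdxi[OF h]]
  have "\<exists>d>0. \<forall>w\<in>closure tri. norm (w - z) < d \<longrightarrow> norm (h w - h z - L z (w - z)) \<le> e * norm (w - z)"
    if e: "e > 0" for e
  proof -
    have "\<exists>d>0. \<forall>w\<in>closure tri. dist w z < d \<longrightarrow> dist (f w) (f z) < e / 2"
      if "continuous_on (closure tri) f" for f :: "real \<times> real \<Rightarrow> real"
      using that z e unfolding continuous_on_iff by (meson half_gt_zero)
    from this[OF c(2)] this[OF c(3)] obtain d1 d2 where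
      d1: "d1 > 0" "\<And>w. w \<in> closure tri \<Longrightarrow> dist w z < d1 \<Longrightarrow> dist (pdx h w) (pdx h z) < e / 2" and
      d2: "d2 > 0" "\<And>w. w \<in> closure tri \<Longrightarrow> dist w z < d2 \<Longrightarrow> dist (pdxi h w) (pdxi h z) < e / 2"
      by blast
    define d where "d = min d1 d2"
    define S where "S = tri \<inter> ball z d"
    have "convex S" unfolding S_def by (intro convex_Int convex_tri convex_ball)
    have onorm: "onorm (\<lambda>v. L w v - L z v) \<le> e" if "w \<in> S" for w
    proof (rule onorm_le)
      fix v :: "real \<times> real"
      have w: "w \<in> closure tri" "dist w z < d1" "dist w z < d2"
        using that tri_subset_closure by (auto simp: S_def d_def dist_commute)
      have "norm (L w v - L z v) = \<bar>fst v * (pdx h w - pdx h z) + snd v * (pdxi h w - pdxi h z)\<bar>"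
        by (simp add: L_def algebra_simps)
      also have "\<dots> \<le> \<bar>fst v\<bar> * \<bar>pdx h w - pdx h z\<bar> + \<bar>snd v\<bar> * \<bar>pdxi h w - pdxi h z\<bar>"
        by (metis abs_mult abs_triangle_ineq)
      also have "\<dots> \<le> norm v * (e / 2) + norm v * (e / 2)"
        using d1(2)[OF w(1,2)] d2(2)[OF w(1,3)] norm_fst_le[of "fst v" "snd v"] norm_snd_le[of "snd v" "fst v"]
        by (intro add_mono mult_mono) (auto simp: dist_real_def)
      finally show "norm (L w v - L z v) \<le> e * norm v" by (simp add: algebra_simps)
    qed
    have inner_bound: "norm (h w - h w' - L z (w - w')) \<le> e * norm (w - w')" if "w \<in> S" "w' \<in> S" for w w'
    proof -
      have "norm ((h w - L z w) - (h w' - L z w')) \<le> e * norm (w - w')"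
      proof (rule differentiable_bound[OF \<open>convex S\<close> _ onorm])
        fix u assume "u \<in> S"
        then have "(h has_derivative L u) (at u within S)"
          unfolding L_def using has_derivative_tri[OF h, of u]
          by (auto simp: S_def intro: has_derivative_at_withinI)
        then show "((\<lambda>w. h w - L z w) has_derivative (\<lambda>v. L u v - L z v)) (at u within S)"
          by (intro has_derivative_diff bounded_linear_imp_has_derivative bl)
      qed (use that in auto)
      then show ?thesis by (simp add: bl_diff algebra_simps)
    qed
    have "norm (h w - h z - L z (w - z)) \<le> e * norm (w - z)"
      if w: "w \<in> closure tri" "norm (w - z) < d" for w
    proof -
      \<comment> \<open>Approximate both points from inside and pass to the limit in the inequality.\<close>
      obtain a where a: "\<And>n. a n \<in> tri" "a \<longlonglongrightarrow> w" using w closure_sequential by blast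
      obtain b where b: "\<And>n. b n \<in> tri" "b \<longlonglongrightarrow> z" using z closure_sequential by blast
      have d0: "d > 0" using d1 d2 by (simp add: d_def)
      have "eventually (\<lambda>n. a n \<in> ball z d) sequentially"
        using a(2) w(2) by (intro topological_tendstoD) (auto simp: dist_norm norm_minus_commute)
      moreover have "eventually (\<lambda>n. b n \<in> ball z d) sequentially"
        using b(2) d0 by (intro topological_tendstoD) auto
      ultimately have le: "eventually (\<lambda>n. norm (h (a n) - h (b n) - L z (a n - b n)) \<le> e * norm (a n - b n)) sequentially"
        by eventually_elim (use a b inner_bound in \<open>auto simp: S_def\<close>)
      have "(\<lambda>n. h (a n)) \<longlonglongrightarrow> h w" "(\<lambda>n. h (b n)) \<longlonglongrightarrow> h z"
        using a b w z
        by (auto intro!: continuous_on_tendsto_compose[OF c(1)] always_eventually intro: tri_subset_closure)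
      then have lhs: "(\<lambda>n. norm (h (a n) - h (b n) - L z (a n - b n))) \<longlonglongrightarrow> norm (h w - h z - L z (w - z))"
        unfolding L_def by (intro tendsto_intros a b)
      have rhs: "(\<lambda>n. e * norm (a n - b n)) \<longlonglongrightarrow> e * norm (w - z)"
        by (intro tendsto_intros a b)
      show ?thesis
        by (rule tendsto_le[OF sequentially_bot rhs lhs le])
    qed
    moreover have "d > 0" using d1 d2 by (simp add: d_def)
    ultimately show ?thesis by blast
  qed
  then have "(h has_derivative L z) (at z within closure tri)"
    unfolding has_derivative_within_alt using bl by blast
  then show ?thesis by (simp add: L_def[abs_def])
qed

text \<open>
  The chain rule along the sides \<open>\<xi> = x\<close> and \<open>\<xi> = 0\<close>.  These sides lie on the boundary, where
  the partial derivatives are only limits; so the total derivative on the closed triangle is essential.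
\<close>

lemma has_real_derivative_diagonal:
  assumes "Ctri (Suc k) h" "x \<in> {0..1}"
  shows "((\<lambda>t. h (t, t)) has_real_derivative pdx h (x, x) + pdxi h (x, x)) (at x within {0..1})"
proof -
  have "((\<lambda>t. h (t, t)) has_derivative (\<lambda>v. fst (v, v) * pdx h (x, x) + snd (v, v) * pdxi h (x, x)))
      (at x within {0..1})"
    by (rule has_derivative_in_compose2[OF has_derivative_closure_tri[OF assms(1)]])
       (use assms(2) in \<open>auto simp: closure_tri intro!: derivative_eq_intros\<close>)
  then show ?thesis
    by (rule has_derivative_imp_has_field_derivative) (simp add: algebra_simps)
qed

lemma has_real_derivative_base:
  assumes "Ctri (Suc k) h" "x \<in> {0..1}"
  shows "((\<lambda>t. h (t, 0)) has_real_derivative pdx h (x, 0)) (at x within {0..1})"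
proof -
  have "((\<lambda>t. h (t, 0)) has_derivative (\<lambda>v. fst (v, 0::real) * pdx h (x, 0) + snd (v, 0::real) * pdxi h (x, 0)))
      (at x within {0..1})"
    by (rule has_derivative_in_compose2[OF has_derivative_closure_tri[OF assms(1)]])
       (use assms(2) in \<open>auto simp: closure_tri intro!: derivative_eq_intros\<close>)
  then show ?thesis
    by (rule has_derivative_imp_has_field_derivative) (simp add: algebra_simps)
qed

lemma box_in_tri:
  assumes "(x, y) \<in> tri" "d > 0"
  obtains s where "s > 0" "\<And>u v. u \<in> {x..x+s} \<Longrightarrow> v \<in> {y..y+s} \<Longrightarrow> (u, v) \<in> tri \<and> dist (u, v) (x, y) < d"
proof -
  obtain e where e: "e > 0" "ball (x, y) e \<subseteq> tri"
    using open_tri assms open_contains_ball by blast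
  define s where "s = min d e / 3"
  have "dist (u, v) (x, y) < min d e" if "u \<in> {x..x+s}" "v \<in> {y..y+s}" for u v
  proof -
    have "dist (u, v) (x, y) \<le> \<bar>u - x\<bar> + \<bar>v - y\<bar>"
      unfolding dist_Pair_Pair dist_real_def using sqrt_sum_squares_le_sum_abs by auto
    also have "\<dots> \<le> 2 * s" using that by auto
    also have "\<dots> < min d e" using e assms by (auto simp: s_def)
    finally show ?thesis .
  qed
  then show ?thesis
    using e assms by (intro that[of s]) (auto simp: s_def dist_commute subset_iff)
qed

text \<open>
  Schwarz's theorem.  The second difference of \<open>h\<close> over a small square with side \<open>s\<close> can be expanded by the
  mean value theorem in either order, so \<open>s\<^sup>2\<close> times either mixed derivative, at some point of the
  square, is the same number; let the square shrink.
\<close>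

lemma pdx_pdxi_commute_tri:
  assumes h: "Ctri (Suc (Suc k)) h" and z: "z \<in> tri"
  shows "pdx (pdxi h) z = pdxi (pdx h) z"
proof -
  obtain x y where xy: "z = (x, y)" by (cases z)
  note h1 = Ctri_SucD[OF h]
  let ?F = "pdx (pdxi h)" and ?G = "pdxi (pdx h)"
  have c: "continuous_on (closure tri) ?F" "continuous_on (closure tri) ?G"
    using h by (auto intro!: Ctri_continuous[of k] Ctri_Suc_pdx Ctri_Suc_pdxi)
  have "\<bar>?F z - ?G z\<bar> < e" if e: "e > 0" for e
  proof -
    have "\<exists>d>0. \<forall>w\<in>closure tri. dist w z < d \<longrightarrow> dist (f w) (f z) < e / 2"
      if "continuous_on (closure tri) f" for f :: "real \<times> real \<Rightarrow> real"
      using that tri_subset_closure[OF z] e unfolding continuous_on_iff by (meson half_gt_zero)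
    from this[OF c(1)] this[OF c(2)] obtain d1 d2 where
      d1: "d1 > 0" "\<And>w. w \<in> closure tri \<Longrightarrow> dist w z < d1 \<Longrightarrow> dist (?F w) (?F z) < e / 2" and
      d2: "d2 > 0" "\<And>w. w \<in> closure tri \<Longrightarrow> dist w z < d2 \<Longrightarrow> dist (?G w) (?G z) < e / 2"
      by blast
    obtain s where s: "s > 0" "\<And>u v. u \<in> {x..x+s} \<Longrightarrow> v \<in> {y..y+s} \<Longrightarrow> (u, v) \<in> tri \<and> dist (u, v) (x, y) < min d1 d2"
      using box_in_tri[of x y "min d1 d2"] z d1 d2 xy by auto
    define \<Delta> where "\<Delta> = h (x + s, y + s) - h (x + s, y) - h (x, y + s) + h (x, y)"
    have in_tri: "(u, v) \<in> tri" if "u \<in> {x..x+s}" "v \<in> {y..y+s}" for u v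
      using s(2) that by blast
    \<comment> \<open>First in \<open>x\<close>, then in \<open>\<xi>\<close>.\<close>
    have "\<exists>u. x < u \<and> u < x + s \<and> (h (x+s, y+s) - h (x+s, y)) - (h (x, y+s) - h (x, y)) =
        (x + s - x) * (pdx h (u, y+s) - pdx h (u, y))"
      by (rule MVT2) (use s in \<open>auto intro!: derivative_eq_intros Ctri_has_derivative_sections[OF h1] in_tri\<close>)
    then obtain u where u: "x < u" "u < x + s" "\<Delta> = s * (pdx h (u, y+s) - pdx h (u, y))"
      by (auto simp: \<Delta>_def)
    have "\<exists>v. y < v \<and> v < y + s \<and> pdx h (u, y+s) - pdx h (u, y) = (y + s - y) * ?G (u, v)"
      by (rule MVT2) (use s u in \<open>auto intro!: derivative_eq_intros
        Ctri_has_derivative_sections[OF Ctri_Suc_pdx[OF h]] in_tri\<close>)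
    then obtain v where v: "y < v" "v < y + s" "\<Delta> = s * (s * ?G (u, v))"
      using u by auto
    \<comment> \<open>First in \<open>\<xi>\<close>, then in \<open>x\<close>.\<close>
    have "\<exists>v'. y < v' \<and> v' < y + s \<and> (h (x+s, y+s) - h (x, y+s)) - (h (x+s, y) - h (x, y)) =
        (y + s - y) * (pdxi h (x+s, v') - pdxi h (x, v'))"
      by (rule MVT2) (use s in \<open>auto intro!: derivative_eq_intros Ctri_has_derivative_sections[OF h1] in_tri\<close>)
    then obtain v' where v': "y < v'" "v' < y + s" "\<Delta> = s * (pdxi h (x+s, v') - pdxi h (x, v'))"
      by (auto simp: \<Delta>_def)
    have "\<exists>u'. x < u' \<and> u' < x + s \<and> pdxi h (x+s, v') - pdxi h (x, v') = (x + s - x) * ?F (u', v')"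
      by (rule MVT2) (use s v' in \<open>auto intro!: derivative_eq_intros
        Ctri_has_derivative_sections[OF Ctri_Suc_pdxi[OF h]] in_tri\<close>)
    then obtain u' where u': "x < u'" "u' < x + s" "\<Delta> = s * (s * ?F (u', v'))"
      using v' by auto
    have "?F (u', v') = ?G (u, v)" using u' v s by simp
    moreover have "dist (?F (u', v')) (?F z) < e / 2"
      using s(2)[of u' v'] u' v' tri_subset_closure xy by (intro d1) auto
    moreover have "dist (?G (u, v)) (?G z) < e / 2"
      using s(2)[of u v] u v tri_subset_closure xy by (intro d2) auto
    ultimately show ?thesis unfolding dist_real_def by linarith
  qed
  from this[of "\<bar>?F z - ?G z\<bar>"] show ?thesis by fastforce
qed

lemma pdx_pdxi_commute:
  assumes h: "Ctri (Suc (Suc k)) h" and z: "z \<in> closure tri"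
  shows "pdx (pdxi h) z = pdxi (pdx h) z"
  by (rule eq_on_closure_tri[OF _ _ pdx_pdxi_commute_tri[OF h] z])
     (use h in \<open>auto intro!: Ctri_continuous[of k] Ctri_Suc_pdx Ctri_Suc_pdxi\<close>)

section \<open>Mixed derivatives of higher order\<close>

text \<open>
  The indices are the numbers of differentiations in \<open>x\<close> and in \<open>\<xi>\<close>.  Unlike \<open>pd\<close>, which is given
  the total order \<open>a + b\<close>, this allows separate inductions on \<open>a\<close> and \<open>b\<close>.
\<close>

definition mixed :: "nat \<Rightarrow> nat \<Rightarrow> (real \<times> real \<Rightarrow> real) \<Rightarrow> real \<times> real \<Rightarrow> real" where
  "mixed a b h = (pdx ^^ a) ((pdxi ^^ b) h)"

lemma mixed_0_0 [simp]: "mixed 0 0 h = h"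
  by (simp add: mixed_def)

lemma mixed_Suc_xi: "mixed a (Suc b) h = mixed a b (pdxi h)"
  by (simp add: mixed_def funpow_Suc_right del: funpow.simps)

lemma mixed_Suc_x: "mixed (Suc a) 0 h = mixed a 0 (pdx h)"
  by (simp add: mixed_def funpow_Suc_right del: funpow.simps(2))

lemma mixed_cong:
  assumes "\<And>z. z \<in> closure tri \<Longrightarrow> f z = g z" "z \<in> closure tri"
  shows "mixed a b f z = mixed a b g z"
proof -
  have "pdx f = pdx g" "pdxi f = pdxi g"
    by (auto intro!: pdx_cong pdxi_cong assms tri_subset_closure)
  then show ?thesis
    by (cases b; cases a) (simp_all add: mixed_Suc_xi mixed_Suc_x assms)
qed

text \<open>
  By symmetry of the second derivatives a derivative in \<open>x\<close> taken first may be moved past those in \<open>\<xi>\<close>.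
\<close>

lemma mixed_pdx:
  "Ctri (Suc (a + b)) h \<Longrightarrow> z \<in> closure tri \<Longrightarrow> mixed a b (pdx h) z = mixed (Suc a) b h z"
proof (induction b arbitrary: h)
  case 0
  then show ?case by (simp add: mixed_Suc_x)
next
  case (Suc b)
  have "mixed a (Suc b) (pdx h) z = mixed a b (pdx (pdxi h)) z"
    unfolding mixed_Suc_xi using Suc.prems
    by (intro mixed_cong pdx_pdxi_commute[symmetric]) auto
  also have "\<dots> = mixed (Suc a) b (pdxi h) z"
    using Suc.prems by (intro Suc.IH Ctri_Suc_pdxi) auto
  finally show ?case by (simp add: mixed_Suc_xi)
qed

lemma mixed_add:
  "Ctri (a + b) f \<Longrightarrow> Ctri (a + b) g \<Longrightarrow> z \<in> closure tri \<Longrightarrow>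
    mixed a b (\<lambda>z. f z + g z) z = mixed a b f z + mixed a b g z"
proof (induction b arbitrary: f g)
  case 0
  then show ?case
  proof (induction a arbitrary: f g)
    case (Suc a)
    have "mixed a 0 (pdx (\<lambda>z. f z + g z)) z = mixed a 0 (\<lambda>z. pdx f z + pdx g z) z"
      using Suc.prems by (intro mixed_cong pdx_add[of a]) auto
    also have "\<dots> = mixed a 0 (pdx f) z + mixed a 0 (pdx g) z"
      using Suc.prems by (intro Suc.IH) (auto intro: Ctri_Suc_pdx)
    finally show ?case by (simp add: mixed_Suc_x)
  qed auto
next
  case (Suc b)
  have "mixed a b (pdxi (\<lambda>z. f z + g z)) z = mixed a b (\<lambda>z. pdxi f z + pdxi g z) z"
    using Suc.prems by (intro mixed_cong pdxi_add[of "a + b"]) auto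
  also have "\<dots> = mixed a b (pdxi f) z + mixed a b (pdxi g) z"
    using Suc.prems by (intro Suc.IH) (auto intro: Ctri_Suc_pdxi)
  finally show ?case by (simp add: mixed_Suc_xi)
qed

lemma mixed_zero: "z \<in> closure tri \<Longrightarrow> mixed a b (\<lambda>_. 0) z = 0"
proof (induction b)
  case 0
  then show ?case
  proof (induction a)
    case (Suc a)
    then have "mixed a 0 (pdx (\<lambda>_. 0)) z = mixed a 0 (\<lambda>_. 0) z"
      by (intro mixed_cong pdx_const) auto
    with Suc show ?case by (simp add: mixed_Suc_x)
  qed auto
next
  case (Suc b)
  then have "mixed a b (pdxi (\<lambda>_. 0)) z = mixed a b (\<lambda>_. 0) z"
    by (intro mixed_cong pdxi_const) auto
  with Suc show ?case by (simp add: mixed_Suc_xi)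
qed

lemma Ctri_sum: "(\<And>i. i \<in> I \<Longrightarrow> Ctri k (f i)) \<Longrightarrow> Ctri k (\<lambda>z. \<Sum>i\<in>I. f i z)"
  by (induction I rule: infinite_finite_induct) (auto intro: Ctri_const Ctri_add)

lemma mixed_sum:
  assumes "\<And>i. i \<in> I \<Longrightarrow> Ctri (a + b) (f i)" "z \<in> closure tri"
  shows "mixed a b (\<lambda>z. \<Sum>i\<in>I. f i z) z = (\<Sum>i\<in>I. mixed a b (f i) z)"
  using assms(1)
proof (induction I rule: infinite_finite_induct)
  case (insert i I)
  then show ?case by (simp add: mixed_add Ctri_sum assms(2))
qed (auto simp: mixed_zero assms(2))

text \<open>
  The induction step shared by the Leibniz rules and by the iterated derivative along the diagonal.
\<close>

lemma sum_Pascal: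
  fixes w :: "nat \<Rightarrow> real"
  shows "(\<Sum>i\<le>n. real (n choose i) * (w i + w (Suc i))) = (\<Sum>i\<le>Suc n. real (Suc n choose i) * w i)"
proof -
  have "(\<Sum>i\<le>Suc n. real (Suc n choose i) * w i)
      = w 0 + (\<Sum>i\<le>n. real (n choose Suc i) * w (Suc i)) + (\<Sum>i\<le>n. real (n choose i) * w (Suc i))"
    by (subst sum.atMost_Suc_shift) (simp add: sum.distrib algebra_simps)
  also have "w 0 + (\<Sum>i\<le>n. real (n choose Suc i) * w (Suc i)) = (\<Sum>i\<le>Suc n. real (n choose i) * w i)"
    by (subst sum.atMost_Suc_shift) simp
  finally show ?thesis by (simp add: sum.distrib algebra_simps)
qed

text \<open>
  Leibniz rule for a factor depending on \<open>\<xi>\<close> alone: such a factor is constant for the differentiations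
  in \<open>x\<close>, so only the \<open>b\<close> differentiations in \<open>\<xi>\<close> distribute.
\<close>

lemma mixed_mult_snd:
  "C01 (a + b) g \<Longrightarrow> Ctri (a + b) h \<Longrightarrow> z \<in> closure tri \<Longrightarrow>
    mixed a b (\<lambda>z. g (snd z) * h z) z =
      (\<Sum>\<sigma>\<le>b. real (b choose \<sigma>) * ((deriv01 ^^ \<sigma>) g (snd z) * mixed a (b - \<sigma>) h z))"
proof (induction b arbitrary: g h)
  case 0
  then show ?case
  proof (induction a arbitrary: h)
    case (Suc a)
    have "mixed a 0 (pdx (\<lambda>z. g (snd z) * h z)) z = mixed a 0 (\<lambda>z. g (snd z) * pdx h z) z"
      using Suc.prems by (intro mixed_cong) (simp_all add: pdx_mult[of a] Ctri_snd pdx_snd)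
    also have "\<dots> = g (snd z) * mixed a 0 (pdx h) z"
      using Suc.IH[of "pdx h"] Suc.prems by (auto intro: Ctri_Suc_pdx C01_SucD)
    finally show ?case by (simp add: mixed_Suc_x)
  qed auto
next
  case (Suc b)
  define w where "w \<sigma> = (deriv01 ^^ \<sigma>) g (snd z) * mixed a (Suc b - \<sigma>) h z" for \<sigma>
  have g: "C01 (Suc (a + b)) g" and h: "Ctri (Suc (a + b)) h" using Suc.prems by auto
  have "mixed a b (pdxi (\<lambda>z. g (snd z) * h z)) z
      = mixed a b (\<lambda>z. deriv01 g (snd z) * h z + g (snd z) * pdxi h z) z"
    using Suc.prems by (intro mixed_cong) (simp_all add: pdxi_mult[of "a + b"] Ctri_snd pdxi_snd[of "a + b"])
  also have "\<dots> = mixed a b (\<lambda>z. deriv01 g (snd z) * h z) z + mixed a b (\<lambda>z. g (snd z) * pdxi h z) z"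
    using g h Suc.prems(3)
    by (intro mixed_add Ctri_mult Ctri_snd) (auto intro: Ctri_Suc_pdxi C01_Suc_deriv01 Ctri_SucD C01_SucD)
  also have "mixed a b (\<lambda>z. deriv01 g (snd z) * h z) z = (\<Sum>\<sigma>\<le>b. real (b choose \<sigma>) * w (Suc \<sigma>))"
    using g h Suc.prems(3)
    by (subst Suc.IH) (auto intro: C01_Suc_deriv01 Ctri_SucD simp: w_def funpow_Suc_right simp del: funpow.simps)
  also have "mixed a b (\<lambda>z. g (snd z) * pdxi h z) z = (\<Sum>\<sigma>\<le>b. real (b choose \<sigma>) * w \<sigma>)"
    using g h Suc.prems(3)
    by (subst Suc.IH) (auto intro: Ctri_Suc_pdxi C01_SucD simp: w_def Suc_diff_le mixed_Suc_xi)
  finally show ?case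
    using sum_Pascal[of b w]
    by (simp add: mixed_Suc_xi w_def sum.distrib distrib_left add.commute del: sum.atMost_Suc funpow.simps)
qed

lemma mixed_mult_fst:
  "C01 (a + b) g \<Longrightarrow> Ctri (a + b) h \<Longrightarrow> z \<in> closure tri \<Longrightarrow>
    mixed a b (\<lambda>z. g (fst z) * h z) z =
      (\<Sum>\<sigma>\<le>a. real (a choose \<sigma>) * ((deriv01 ^^ \<sigma>) g (fst z) * mixed (a - \<sigma>) b h z))"
proof (induction a arbitrary: g h)
  case 0
  then show ?case
  proof (induction b arbitrary: h)
    case (Suc b)
    have "mixed 0 b (pdxi (\<lambda>z. g (fst z) * h z)) z = mixed 0 b (\<lambda>z. g (fst z) * pdxi h z) z"
      using Suc.prems by (intro mixed_cong) (simp_all add: pdxi_mult[of b] Ctri_fst pdxi_fst)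
    also have "\<dots> = g (fst z) * mixed 0 b (pdxi h) z"
      using Suc.IH[of "pdxi h"] Suc.prems by (auto intro: Ctri_Suc_pdxi C01_SucD)
    finally show ?case by (simp add: mixed_Suc_xi)
  qed auto
next
  case (Suc a)
  define w where "w \<sigma> = (deriv01 ^^ \<sigma>) g (fst z) * mixed (Suc a - \<sigma>) b h z" for \<sigma>
  have g: "C01 (Suc (a + b)) g" and h: "Ctri (Suc (a + b)) h" using Suc.prems by auto
  have "mixed (Suc a) b (\<lambda>z. g (fst z) * h z) z = mixed a b (pdx (\<lambda>z. g (fst z) * h z)) z"
    using g h Suc.prems(3) by (intro mixed_pdx[symmetric] Ctri_mult Ctri_fst)
  also have "\<dots> = mixed a b (\<lambda>z. deriv01 g (fst z) * h z + g (fst z) * pdx h z) z"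
    using Suc.prems by (intro mixed_cong) (simp_all add: pdx_mult[of "a + b"] Ctri_fst pdx_fst[of "a + b"])
  also have "\<dots> = mixed a b (\<lambda>z. deriv01 g (fst z) * h z) z + mixed a b (\<lambda>z. g (fst z) * pdx h z) z"
    using g h Suc.prems(3)
    by (intro mixed_add Ctri_mult Ctri_fst) (auto intro: Ctri_Suc_pdx C01_Suc_deriv01 Ctri_SucD C01_SucD)
  also have "mixed a b (\<lambda>z. deriv01 g (fst z) * h z) z = (\<Sum>\<sigma>\<le>a. real (a choose \<sigma>) * w (Suc \<sigma>))"
    using g h Suc.prems(3)
    by (subst Suc.IH) (auto intro: C01_Suc_deriv01 Ctri_SucD simp: w_def funpow_Suc_right simp del: funpow.simps)
  also have "mixed a b (\<lambda>z. g (fst z) * pdx h z) z = (\<Sum>\<sigma>\<le>a. real (a choose \<sigma>) * w \<sigma>)"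
  proof -
    have "mixed (a - \<sigma>) b (pdx h) z = mixed (Suc a - \<sigma>) b h z" if "\<sigma> \<le> a" for \<sigma>
      using that Suc.prems(3) by (simp add: Suc_diff_le mixed_pdx Ctri_mono[OF h])
    then show ?thesis
      using g h Suc.prems(3)
      by (subst Suc.IH) (auto intro: Ctri_Suc_pdx C01_SucD simp: w_def)
  qed
  finally show ?case
    using sum_Pascal[of a w]
    by (simp add: w_def sum.distrib distrib_left add.commute del: sum.atMost_Suc funpow.simps)
qed

section \<open>Derivatives along the sides of the triangle\<close>

lemma deriv01_cong:
  assumes "\<And>x. x \<in> {0..1} \<Longrightarrow> f x = g x" "x \<in> {0..1}"
  shows "deriv01 f x = deriv01 g x"
proof -
  have "(f has_vector_derivative D) (at x within {0..1}) \<longleftrightarrow>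
      (g has_vector_derivative D) (at x within {0..1})" for D
    using assms by (metis has_vector_derivative_transform)
  then show ?thesis by (simp add: deriv01_def vector_derivative_def)
qed

lemma deriv01_iter_cong:
  assumes "\<And>x. x \<in> {0..1} \<Longrightarrow> f x = g x" "x \<in> {0..1}"
  shows "(deriv01 ^^ k) f x = (deriv01 ^^ k) g x"
  using assms(2)
  by (induction k arbitrary: x) (auto simp: assms intro: deriv01_cong)

lemma deriv01_iter_base:
  "Ctri N h \<Longrightarrow> x \<in> {0..1} \<Longrightarrow> (deriv01 ^^ N) (\<lambda>t. h (t, 0)) x = mixed N 0 h (x, 0)"
proof (induction N arbitrary: h)
  case (Suc N)
  have "(deriv01 ^^ N) (deriv01 (\<lambda>t. h (t, 0))) x = (deriv01 ^^ N) (\<lambda>t. pdx h (t, 0)) x"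
    using Suc.prems by (intro deriv01_iter_cong deriv01_eqI has_real_derivative_base) auto
  also have "\<dots> = mixed N 0 (pdx h) (x, 0)"
    using Suc.prems by (intro Suc.IH Ctri_Suc_pdx)
  finally show ?case by (simp add: mixed_Suc_x funpow_Suc_right del: funpow.simps)
qed auto

text \<open>
  The operator \<open>\<partial>\<^sub>x + \<partial>\<^sub>\<xi>\<close> is differentiation along the diagonal, and its power expands binomially
  because the partial derivatives commute.  This is the origin of the binomial last row of \<open>J\<close>.
\<close>

lemma deriv01_iter_diagonal:
  "Ctri N h \<Longrightarrow> x \<in> {0..1} \<Longrightarrow>
    (deriv01 ^^ N) (\<lambda>t. h (t, t)) x = (\<Sum>i\<le>N. real (N choose i) * mixed (N - i) i h (x, x))"
proof (induction N arbitrary: h)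
  case (Suc N)
  have x: "(x, x) \<in> closure tri" using Suc.prems by (auto simp: closure_tri)
  define w where "w i = mixed (Suc N - i) i h (x, x)" for i
  have "(deriv01 ^^ N) (deriv01 (\<lambda>t. h (t, t))) x = (deriv01 ^^ N) (\<lambda>t. pdx h (t, t) + pdxi h (t, t)) x"
    using Suc.prems by (intro deriv01_iter_cong deriv01_eqI has_real_derivative_diagonal) auto
  also have "\<dots> = (\<Sum>i\<le>N. real (N choose i) * mixed (N - i) i (\<lambda>z. pdx h z + pdxi h z) (x, x))"
    using Suc.prems by (intro Suc.IH Ctri_add Ctri_Suc_pdx Ctri_Suc_pdxi)
  also have "\<dots> = (\<Sum>i\<le>N. real (N choose i) * (w i + w (Suc i)))"
  proof (intro sum.cong refl arg_cong2[where f = "(*)"])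
    fix i assume "i \<in> {..N}"
    then have i: "i \<le> N" by simp
    have "mixed (N - i) i (\<lambda>z. pdx h z + pdxi h z) (x, x) = mixed (N - i) i (pdx h) (x, x) + mixed (N - i) i (pdxi h) (x, x)"
      using Suc.prems i x by (intro mixed_add) (auto intro: Ctri_Suc_pdx Ctri_Suc_pdxi)
    also have "mixed (N - i) i (pdx h) (x, x) = w i"
      using Suc.prems i x by (subst mixed_pdx) (auto simp: w_def Suc_diff_le)
    also have "mixed (N - i) i (pdxi h) (x, x) = w (Suc i)"
      by (simp add: w_def mixed_Suc_xi)
    finally show "mixed (N - i) i (\<lambda>z. pdx h z + pdxi h z) (x, x) = w i + w (Suc i)" .
  qed
  also have "\<dots> = (\<Sum>i\<le>Suc N. real (Suc N choose i) * w i)" by (rule sum_Pascal)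
  finally show ?case by (simp add: w_def funpow_Suc_right del: funpow.simps sum.atMost_Suc)
qed auto

section \<open>Regularity of the transformed coefficients\<close>

lemma C01_cong:
  assumes "\<And>x. x \<in> {0..1} \<Longrightarrow> f x = g x"
  shows "C01 k f \<longleftrightarrow> C01 k g"
  using assms
proof (induction k arbitrary: f g)
  case 0
  then show ?case unfolding C01.simps(1) by (intro continuous_on_cong) auto
next
  case (Suc k)
  have "f differentiable_on {0..1} \<longleftrightarrow> g differentiable_on {0..1}"
    using Suc.prems unfolding differentiable_on_def differentiable_def
    by (metis (no_types, lifting) has_derivative_transform)
  moreover have "C01 k (deriv01 f) \<longleftrightarrow> C01 k (deriv01 g)"
    by (intro Suc.IH deriv01_cong Suc.prems)
  ultimately show ?case by (simp add: C01.simps(2))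
qed

lemma C01I:
  assumes "\<And>x. x \<in> {0..1} \<Longrightarrow> (f has_real_derivative g x) (at x within {0..1})" "C01 k g"
  shows "C01 (Suc k) f"
proof -
  have "C01 k (deriv01 f)"
    using assms by (subst C01_cong[of _ g]) (auto intro: deriv01_eqI)
  then show ?thesis
    using assms(1) unfolding C01.simps(2) differentiable_on_def differentiable_def has_field_derivative_def
    by blast
qed

lemma C01_const: "C01 k (\<lambda>_. c)"
proof (induction k arbitrary: c)
  case (Suc k)
  show ?case by (rule C01I[OF _ Suc[of 0]]) auto
qed auto

lemma C01_add: "C01 k f \<Longrightarrow> C01 k g \<Longrightarrow> C01 k (\<lambda>x. f x + g x)"
proof (induction k arbitrary: f g)
  case (Suc k)
  show ?case
    by (rule C01I[where g = "\<lambda>x. deriv01 f x + deriv01 g x"])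
       (use Suc in \<open>auto intro!: derivative_intros intro: C01_Suc_deriv01 C01_has_real_derivative\<close>)
qed (auto intro: continuous_intros)

lemma C01_mult: "C01 k f \<Longrightarrow> C01 k g \<Longrightarrow> C01 k (\<lambda>x. f x * g x)"
proof (induction k arbitrary: f g)
  case (Suc k)
  show ?case
    by (rule C01I[where g = "\<lambda>x. deriv01 f x * g x + deriv01 g x * f x"])
       (use Suc in \<open>auto intro!: derivative_intros C01_add intro: C01_Suc_deriv01 C01_has_real_derivative C01_SucD\<close>)
qed (auto intro: continuous_intros)

lemma C01_inverse: "C01 k f \<Longrightarrow> (\<And>x. x \<in> {0..1} \<Longrightarrow> f x \<noteq> 0) \<Longrightarrow> C01 k (\<lambda>x. inverse (f x))"
proof (induction k)
  case (Suc k)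
  show ?case
  proof (rule C01I)
    show "((\<lambda>x. inverse (f x)) has_real_derivative ((-1) * (inverse (f x) * (deriv01 f x * inverse (f x)))))
        (at x within {0..1})" if "x \<in> {0..1}" for x
      using that Suc.prems
      by (auto intro!: derivative_eq_intros intro: C01_has_real_derivative)
    show "C01 k (\<lambda>x. (-1) * (inverse (f x) * (deriv01 f x * inverse (f x))))"
      by (intro C01_mult C01_const C01_Suc_deriv01 Suc.prems Suc.IH C01_SucD)
  qed
qed (auto intro!: continuous_intros)

text \<open>
  Bootstrapping: the equation \<open>f' = c f\<close> makes \<open>f\<close> one degree smoother than \<open>c\<close>.
\<close>

lemma C01_linear_ode:
  assumes "\<And>x. x \<in> {0..1} \<Longrightarrow> (f has_real_derivative c x * f x) (at x within {0..1})"
  shows "C01 k c \<Longrightarrow> C01 (Suc k) f"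
proof (induction k)
  case 0
  have "continuous_on {0..1} f"
    using assms by (rule DERIV_continuous_on)
  with 0 show ?case by (intro C01I[OF assms]) (auto intro!: continuous_intros)
next
  case (Suc k)
  show ?case by (rule C01I[OF assms C01_mult[OF Suc.prems Suc.IH[OF C01_SucD[OF Suc.prems]]]])
qed

lemma mat_inverse_mat_diag:
  fixes f :: "nat \<Rightarrow> 'a :: field"
  assumes "\<And>k. k < n \<Longrightarrow> f k \<noteq> 0"
  shows "mat_inverse (mat_diag n f) = Some (mat_diag n (\<lambda>k. inverse (f k)))"
proof -
  let ?D = "mat_diag n f" and ?E = "mat_diag n (\<lambda>k. inverse (f k))"
  have c: "?D \<in> carrier_mat n n" "?E \<in> carrier_mat n n" by simp_all
  have i: "?E * ?D = 1\<^sub>m n" "?D * ?E = 1\<^sub>m n"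
    unfolding mat_diag_diag using assms by (auto simp: mat_diag_def intro!: eq_matI)
  then have "?D \<in> Units (ring_mat TYPE('a) n ())"
    using c i unfolding Units_def ring_mat_simps by blast
  with mat_inverse(1)[OF c(1), of "()"] obtain B where B: "mat_inverse ?D = Some B"
    by (cases "mat_inverse ?D") auto
  then have "B \<in> carrier_mat n n" "?D * B = 1\<^sub>m n" using mat_inverse(2)[OF c(1) B] by auto
  then have "B = (?E * ?D) * B" unfolding i by simp
  also have "\<dots> = ?E * (?D * B)" by (rule assoc_mult_mat[OF c(2,1) \<open>B \<in> carrier_mat n n\<close>])
  also have "\<dots> = ?E" unfolding \<open>?D * B = 1\<^sub>m n\<close> by (rule right_mult_one_mat[OF c(2)])
  finally show ?thesis by (simp add: B)
qed

lemma M0_entry: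
  assumes "M x \<in> carrier_mat n n" "i < n" "j < n"
  shows "M0 n lam M x $$ (i, j) =
    (Dmat n lam M x $$ (i, i) * M x $$ (i, j) + lam i x * deriv01 (\<lambda>t. Dmat n lam M t $$ (i, j)) x)
      * inverse (Dmat n lam M x $$ (j, j))"
proof -
  define d where "d k x = exp (- integral {0..x} (\<lambda>\<xi>. M \<xi> $$ (k, k) / lam k \<xi>))" for k x
  have D: "Dmat n lam M = (\<lambda>x. mat_diag n (\<lambda>k. d k x))"
    by (simp add: Dmat_def d_def fun_eq_iff)
  have inv: "the (mat_inverse (Dmat n lam M x)) = mat_diag n (\<lambda>k. inverse (d k x))"
    unfolding D by (subst mat_inverse_mat_diag) (auto simp: d_def)
  have c: "mderiv01 (Dmat n lam M) x \<in> carrier_mat n n"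
    by (simp add: mderiv01_def D mat_diag_def)
  define X where "X = Dmat n lam M x * M x + Lam n lam x * mderiv01 (Dmat n lam M) x"
  have X: "X \<in> carrier_mat n n"
    unfolding X_def Lam_def
    by (rule add_carrier_mat, rule mult_carrier_mat[OF _ c], simp)
  have "M0 n lam M x $$ (i, j) = X $$ (i, j) * inverse (d j x)"
    unfolding M0_def inv X_def[symmetric] using assms by (simp add: mat_diag_mult_right[OF X])
  also have "X $$ (i, j) = d i x * M x $$ (i, j) + lam i x * mderiv01 (Dmat n lam M) x $$ (i, j)"
    unfolding X_def Lam_def mat_diag_mult_left[OF c]
    unfolding D mat_diag_mult_left[OF assms(1)] using assms(2,3) by simp
  also have "mderiv01 (Dmat n lam M) x $$ (i, j) = deriv01 (\<lambda>t. Dmat n lam M t $$ (i, j)) x"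
    using assms by (simp add: mderiv01_def D mat_diag_def)
  finally show ?thesis
    using assms by (simp add: D mat_diag_def)
qed

text \<open>
  The entry \<open>e\<^sup>-\<^sup>I\<close> with \<open>I' = m\<^sub>i\<^sub>i / \<lambda>\<^sub>i\<close> solves a linear equation, hence gains one derivative.  This gain
  pays for the \<open>D'\<close> in \<open>M\<^sup>0\<close>.
\<close>

lemma C01_Dmat:
  assumes "C01 k (\<lambda>x. M x $$ (i, i))" "C01 k (lam i)" "\<And>x. x \<in> {0..1} \<Longrightarrow> lam i x \<noteq> 0"
    and "i < n"
  shows "C01 (Suc k) (\<lambda>x. Dmat n lam M x $$ (i, i))"
proof -
  define c where "c x = M x $$ (i, i) / lam i x" for x
  have c: "C01 k c"
    unfolding c_def divide_inverse by (intro C01_mult C01_inverse assms)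
  have "C01 (Suc k) (\<lambda>x. exp (- integral {0..x} c))"
  proof (rule C01_linear_ode)
    show "C01 k (\<lambda>x. (-1) * c x)" by (intro C01_mult C01_const c)
    show "((\<lambda>x. exp (- integral {0..x} c)) has_real_derivative (-1) * c x * exp (- integral {0..x} c))
        (at x within {0..1})" if "x \<in> {0..1}" for x
      using that integral_has_real_derivative[OF C01_continuous[OF c] that]
      by (auto intro!: derivative_eq_intros)
  qed
  moreover have "Dmat n lam M x $$ (i, i) = exp (- integral {0..x} c)" for x
    using assms(4) by (simp add: Dmat_def mat_diag_def c_def[abs_def])
  ultimately show ?thesis by simp
qed

lemma C01_M0:
  assumes "C01_mat n (Suc k) M" "\<And>i. i < n \<Longrightarrow> C01 (Suc k) (lam i)"
    and "\<And>x i. x \<in> {0..1} \<Longrightarrow> i < n \<Longrightarrow> lam i x \<noteq> 0" and ij: "i < n" "j < n"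
  shows "C01 (Suc k) (\<lambda>x. M0 n lam M x $$ (i, j))"
proof -
  have M: "M x \<in> carrier_mat n n" if "x \<in> {0..1}" for x
    using assms(1) that by (simp add: C01_mat_def)
  have CM: "C01 (Suc k) (\<lambda>x. M x $$ (l, l'))" if "l < n" "l' < n" for l l'
    using assms(1) that by (simp add: C01_mat_def)
  have CD: "C01 (Suc (Suc k)) (\<lambda>x. Dmat n lam M x $$ (l, l))" if "l < n" for l
    by (intro C01_Dmat CM assms that)
  have CD': "C01 (Suc (Suc k)) (\<lambda>x. Dmat n lam M x $$ (i, j))"
  proof (cases "i = j")
    case True
    then show ?thesis using CD[of i] ij by simp
  next
    case False
    then have "(\<lambda>x. Dmat n lam M x $$ (i, j)) = (\<lambda>_. 0)"
      using ij by (simp add: Dmat_def mat_diag_def)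
    then show ?thesis by (simp add: C01_const)
  qed
  have nz: "Dmat n lam M x $$ (j, j) \<noteq> 0" for x
    using ij by (simp add: Dmat_def mat_diag_def)
  have "C01 (Suc k) (\<lambda>x. (Dmat n lam M x $$ (i, i) * M x $$ (i, j) + lam i x * deriv01 (\<lambda>t. Dmat n lam M t $$ (i, j)) x)
      * inverse (Dmat n lam M x $$ (j, j)))"
    by (intro C01_mult C01_add C01_inverse CM assms ij C01_SucD[OF CD] C01_Suc_deriv01[OF CD'] nz)
  then show ?thesis
    by (subst C01_cong[OF M0_entry[OF M ij]]) auto
qed

section \<open>The coefficient matrices of the differentiated equations\<close>

text \<open>
  A row with at most one nonzero entry picks a multiple of one row of the other factor.  All rows of the
  matrices \<open>R\<close>, \<open>S\<close> and their variant for \<open>\<lambda>\<^sub>\<alpha>\<close> are of this kind, so these matrices only place the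
  binomial coefficients of the Leibniz rule.
\<close>

lemma index_mult_selection_row:
  fixes A X :: "real mat"
  assumes "A \<in> carrier_mat nr k" "X \<in> carrier_mat k n" "i < nr" "j < n"
    and "\<And>c. c < k \<Longrightarrow> A $$ (i, c) = (if P \<and> c = f then a else 0)"
    and "P \<Longrightarrow> f < k"
  shows "(A * X) $$ (i, j) = (if P then a * X $$ (f, j) else 0)"
proof -
  have "(A * X) $$ (i, j) = (\<Sum>c = 0..<k. A $$ (i, c) * X $$ (c, j))"
    using assms(1-4) by (simp add: scalar_prod_def)
  also have "\<dots> = (\<Sum>c = 0..<k. if c = f then (if P then a * X $$ (f, j) else 0) else 0)"
    by (rule sum.cong) (auto simp: assms(5))
  also have "\<dots> = (if P then a * X $$ (f, j) else 0)"
    using assms(6) by (auto simp: sum.delta)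
  finally show ?thesis .
qed

lemma Rmat_carrier: "\<sigma> < N \<Longrightarrow> Rmat N \<sigma> \<in> carrier_mat N (N - \<sigma>)"
  by (auto simp: Rmat_def Emat_def append_rows_def mat_diag_def four_block_mat_def Let_def)

lemma Rmat_mult_index:
  assumes "\<sigma> < N" "l < N" "X \<in> carrier_mat (N - \<sigma>) n" "j < n"
  shows "(Rmat N \<sigma> * X) $$ (l, j) = (if \<sigma> \<le> l then real (l choose \<sigma>) * X $$ (l - \<sigma>, j) else 0)"
  by (rule index_mult_selection_row[OF Rmat_carrier assms(3)])
     (use assms in \<open>auto simp: Rmat_def Emat_def append_rows_def mat_diag_def four_block_mat_def Let_def\<close>)

lemma Scheck_carrier: "\<sigma> < N \<Longrightarrow> Scheck N \<sigma> \<in> carrier_mat N (N - \<sigma> + 1)"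
  by (auto simp: Scheck_def Echeck_def mat_diag_def four_block_mat_def Let_def)

lemma Scheck_mult_index:
  assumes "\<sigma> < N" "l < N" "X \<in> carrier_mat (N - \<sigma> + 1) n" "j < n"
  shows "(Scheck N \<sigma> * X) $$ (l, j) =
    (if l < N - \<sigma> then real ((N - 1 - l) choose \<sigma>) * X $$ (l, j) else 0)"
  by (rule index_mult_selection_row[OF Scheck_carrier assms(3)])
     (use assms in \<open>auto simp: Scheck_def Echeck_def mat_diag_def four_block_mat_def Let_def\<close>)

lemma Smat_carrier: "\<sigma> < N \<Longrightarrow> Smat N \<sigma> \<in> carrier_mat N (N - \<sigma> + 1)"
  by (auto simp: Smat_def Emat_def mat_diag_def four_block_mat_def Let_def)

lemma Smat_mult_index:
  assumes "\<sigma> < N" "l < N" "X \<in> carrier_mat (N - \<sigma> + 1) n" "j < n"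
  shows "(Smat N \<sigma> * X) $$ (l, j) =
    (if \<sigma> \<le> l then real (l choose \<sigma>) * X $$ (Suc (l - \<sigma>), j) else 0)"
  by (rule index_mult_selection_row[OF Smat_carrier assms(3)])
     (use assms in \<open>auto simp: Smat_def Emat_def mat_diag_def four_block_mat_def Let_def\<close>)

lemma Jmat_carrier: "Jmat lam N \<alpha> \<beta> \<in> carrier_mat (N + 1) (N + 1)"
  by (simp add: Jmat_def)

lemma Jmat_mult_row:
  assumes "v \<in> carrier_vec (N + 1)" "l < N"
  shows "(Jmat lam N \<alpha> \<beta> *\<^sub>v v) $ l = lam \<alpha> 0 * v $ l + lam \<beta> 0 * v $ Suc l"
proof -
  have "(Jmat lam N \<alpha> \<beta> *\<^sub>v v) $ l = (\<Sum>j = 0..<N + 1. Jmat lam N \<alpha> \<beta> $$ (l, j) * v $ j)"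
    using assms by (simp add: Jmat_def scalar_prod_def)
  also have "\<dots> = (\<Sum>j = 0..<N + 1. (if j = l then lam \<alpha> 0 * v $ l else 0) +
      (if j = Suc l then lam \<beta> 0 * v $ Suc l else 0))"
    using assms by (intro sum.cong) (auto simp: Jmat_def)
  also have "\<dots> = lam \<alpha> 0 * v $ l + lam \<beta> 0 * v $ Suc l"
    using assms(2) by (simp add: sum.distrib del: sum.atLeastLessThan_Suc sum.op_ivl_Suc)
  finally show ?thesis .
qed

lemma Jmat_mult_last_row:
  assumes "v \<in> carrier_vec (N + 1)"
  shows "(Jmat lam N \<alpha> \<beta> *\<^sub>v v) $ N = (if \<beta> \<noteq> \<alpha> then \<Sum>j\<le>N. real (N choose j) * v $ j else v $ 0)"
proof -
  have "(Jmat lam N \<alpha> \<beta> *\<^sub>v v) $ N = (\<Sum>j\<le>N. Jmat lam N \<alpha> \<beta> $$ (N, j) * v $ j)"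
    using assms by (simp add: Jmat_def scalar_prod_def atLeast0LessThan lessThan_Suc_atMost)
  also have "\<dots> = (\<Sum>j\<le>N. if \<beta> \<noteq> \<alpha> then real (N choose j) * v $ j else if j = 0 then v $ 0 else 0)"
    by (intro sum.cong) (auto simp: Jmat_def)
  also have "\<dots> = (if \<beta> \<noteq> \<alpha> then \<Sum>j\<le>N. real (N choose j) * v $ j else v $ 0)"
    by (cases "\<beta> = \<alpha>") simp_all
  finally show ?thesis .
qed

text \<open>
  The first \<open>N\<close> rows force a null vector to be geometric, \<open>v\<^sub>j = q\<^sup>j v\<^sub>0\<close> with \<open>q = -\<lambda>\<^sub>\<alpha>/\<lambda>\<^sub>\<beta>\<close>.  For
  \<open>\<beta> \<noteq> \<alpha>\<close> the last row then reads \<open>(1 + q)\<^sup>N v\<^sub>0 = 0\<close>, where \<open>1 + q = (\<lambda>\<^sub>\<beta> - \<lambda>\<^sub>\<alpha>)/\<lambda>\<^sub>\<beta> \<noteq> 0\<close>; for \<open>\<beta> = \<alpha>\<close>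
  the last row is \<open>v\<^sub>0 = 0\<close> itself.
\<close>

lemma invertible_Jmat:
  assumes "lam \<alpha> 0 \<noteq> 0" "lam \<beta> 0 \<noteq> 0" "\<beta> \<noteq> \<alpha> \<Longrightarrow> lam \<alpha> 0 \<noteq> lam \<beta> 0"
  shows "invertible_mat (Jmat lam N \<alpha> \<beta>)"
proof -
  let ?J = "Jmat lam N \<alpha> \<beta>"
  define q where "q = - lam \<alpha> 0 / lam \<beta> 0"
  have "det ?J \<noteq> 0"
  proof
    assume "det ?J = 0"
    then obtain v where v: "v \<in> carrier_vec (N + 1)" "v \<noteq> 0\<^sub>v (N + 1)" "?J *\<^sub>v v = 0\<^sub>v (N + 1)"
      using det_0_iff_vec_prod_zero_field[OF Jmat_carrier] by blast
    have row: "lam \<alpha> 0 * v $ l + lam \<beta> 0 * v $ Suc l = 0" if "l < N" for l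
      using Jmat_mult_row[OF v(1) that, of lam \<alpha> \<beta>] that by (simp add: v(3))
    have vj: "v $ j = q ^ j * v $ 0" if "j \<le> N" for j
      using that
    proof (induction j)
      case (Suc j)
      then have "v $ Suc j = q * v $ j"
        using row[of j] assms(2) by (simp add: q_def field_simps eq_neg_iff_add_eq_0)
      then show ?case using Suc by simp
    qed simp
    have last: "(?J *\<^sub>v v) $ N = 0" by (simp add: v(3))
    have "v $ 0 = 0"
    proof (cases "\<beta> = \<alpha>")
      case True
      then show ?thesis using Jmat_mult_last_row[OF v(1), of lam \<alpha> \<beta>] last by simp
    next
      case False
      have "0 = (\<Sum>j\<le>N. real (N choose j) * v $ j)"
        using Jmat_mult_last_row[OF v(1), of lam \<alpha> \<beta>] last False by simp
      also have "\<dots> = (\<Sum>j\<le>N. real (N choose j) * q ^ j) * v $ 0"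
        unfolding sum_distrib_right by (intro sum.cong refl) (metis atMost_iff mult.assoc vj)
      also have "(\<Sum>j\<le>N. real (N choose j) * q ^ j) = (q + 1) ^ N"
        by (simp add: binomial_ring)
      finally show ?thesis
        using assms(2,3) False by (auto simp: q_def field_simps)
    qed
    then have "v $ j = 0" if "j \<le> N" for j
      using vj[OF that] by simp
    then have "v = 0\<^sub>v (N + 1)" using v(1) by (intro eq_vecI) auto
    with v(2) show False by simp
  qed
  from det_non_zero_imp_unit[OF Jmat_carrier this, of "()"]
  obtain B where "B \<in> carrier_mat (N + 1) (N + 1)" "B * ?J = 1\<^sub>m (N + 1)" "?J * B = 1\<^sub>m (N + 1)"
    unfolding Units_def ring_mat_simps by blast
  then show ?thesis
    unfolding invertible_mat_def inverts_mat_def using Jmat_carrier[of lam N \<alpha> \<beta>] by (auto intro!: exI[of _ B])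
qed

section \<open>Entries of iterated derivatives of matrices\<close>

text \<open>
  The dimensions of \<open>F\<close> are only known on \<open>[0,1]\<close>; this is enough because the derivative there does not
  depend on values elsewhere.
\<close>

lemma mderiv01_iter:
  assumes "\<And>t. t \<in> {0..1} \<Longrightarrow> F t \<in> carrier_mat nr nc" "x \<in> {0..1}"
  shows "(mderiv01 ^^ k) F x \<in> carrier_mat nr nc"
    and "i < nr \<Longrightarrow> j < nc \<Longrightarrow> (mderiv01 ^^ k) F x $$ (i, j) = (deriv01 ^^ k) (\<lambda>t. F t $$ (i, j)) x"
proof -
  have "(mderiv01 ^^ k) F x \<in> carrier_mat nr nc \<and>
    (i < nr \<longrightarrow> j < nc \<longrightarrow> (mderiv01 ^^ k) F x $$ (i, j) = (deriv01 ^^ k) (\<lambda>t. F t $$ (i, j)) x)"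
    using assms(2)
  proof (induction k arbitrary: x)
    case 0
    then show ?case using assms(1) by auto
  next
    case (Suc k)
    have "(mderiv01 ^^ k) F x \<in> carrier_mat nr nc" using Suc by blast
    moreover have "deriv01 (\<lambda>t. (mderiv01 ^^ k) F t $$ (i, j)) x = deriv01 ((deriv01 ^^ k) (\<lambda>t. F t $$ (i, j))) x"
      if "i < nr" "j < nc" using that Suc by (intro deriv01_cong) blast+
    moreover have "mderiv01 G x \<in> carrier_mat nr nc \<and>
        (i < nr \<longrightarrow> j < nc \<longrightarrow> mderiv01 G x $$ (i, j) = deriv01 (\<lambda>t. G t $$ (i, j)) x)"
      if "G x \<in> carrier_mat nr nc" for G
      using that by (auto simp: mderiv01_def)
    ultimately show ?case by simp
  qed
  then show "(mderiv01 ^^ k) F x \<in> carrier_mat nr nc"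
    and "i < nr \<Longrightarrow> j < nc \<Longrightarrow> (mderiv01 ^^ k) F x $$ (i, j) = (deriv01 ^^ k) (\<lambda>t. F t $$ (i, j)) x"
    by blast+
qed

lemma Lam_carrier: "Lam n lam x \<in> carrier_mat n n"
  by (simp add: Lam_def)

lemma Lam_index: "i < n \<Longrightarrow> j < n \<Longrightarrow> Lam n lam x $$ (i, j) = (if i = j then lam j x else 0)"
  by (simp add: Lam_def mat_diag_def)

lemma M0_carrier: "M0 n lam M x \<in> carrier_mat n n"
proof -
  have "mat_inverse (Dmat n lam M x)
      = Some (mat_diag n (\<lambda>k. inverse (exp (- integral {0..x} (\<lambda>\<xi>. M \<xi> $$ (k, k) / lam k \<xi>)))))"
    unfolding Dmat_def by (rule mat_inverse_mat_diag) simp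
  moreover have "Lam n lam x * mderiv01 (Dmat n lam M) x \<in> carrier_mat n n"
    by (rule mult_carrier_mat[OF Lam_carrier]) (simp add: mderiv01_def Dmat_def mat_diag_def)
  ultimately show ?thesis
    unfolding M0_def by (simp add: add_carrier_mat mult_carrier_mat[of _ n n])
qed

lemma Acoef_carrier: "Acoef n lam M x \<in> carrier_mat n n"
  unfolding Acoef_def by (rule add_carrier_mat[OF M0_carrier])

lemma C01_Acoef:
  assumes "C01_mat n (Suc k) M" "\<And>i. i < n \<Longrightarrow> C01 (Suc k) (lam i)"
    and "\<And>x i. x \<in> {0..1} \<Longrightarrow> i < n \<Longrightarrow> lam i x \<noteq> 0" and ij: "i < n" "j < n"
  shows "C01 k (\<lambda>x. Acoef n lam M x $$ (i, j))"
proof -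
  have L: "C01 (Suc k) (\<lambda>t. Lam n lam t $$ (i, j))"
    using assms by (cases "i = j") (auto simp: Lam_index C01_const)
  have "Acoef n lam M x $$ (i, j) = deriv01 (\<lambda>t. Lam n lam t $$ (i, j)) x + M0 n lam M x $$ (i, j)" for x
    using ij M0_carrier[of n lam M x] Lam_carrier[of n lam x] by (simp add: Acoef_def mderiv01_def)
  then show ?thesis
    using C01_add[OF C01_Suc_deriv01[OF L] C01_SucD[OF C01_M0[OF assms]]] by simp
qed

section \<open>The scalar kernel equations\<close>

text \<open>
  The row equation of the kernel system, differentiated \<open>a\<close> times in \<open>x\<close> and \<open>b\<close> times in \<open>\<xi>\<close> by the
  Leibniz rules.  The terms with \<open>\<sigma> = 0\<close> in the first two sums carry the derivatives of highest
  order \<open>a + b + 1\<close>; the others have lower order.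
\<close>

lemma differentiated_kernel_equation:
  fixes n :: nat
  assumes la: "C01 (a + b) la" and lb: "C01 (a + b) lb"
    and c: "\<And>\<gamma>. \<gamma> < n \<Longrightarrow> C01 (a + b) (c \<gamma>)"
    and k: "\<And>\<gamma>. \<gamma> < n \<Longrightarrow> Ctri (Suc (a + b)) (k \<gamma>)"
    and \<beta>: "\<beta> < n" and z: "z \<in> closure tri"
    and eq: "\<And>z. z \<in> tri \<Longrightarrow> la (fst z) * pdx (k \<beta>) z + lb (snd z) * pdxi (k \<beta>) z
        + (\<Sum>\<gamma><n. c \<gamma> (snd z) * k \<gamma> z) = 0"
  shows "(\<Sum>\<sigma>\<le>a. real (a choose \<sigma>) * ((deriv01 ^^ \<sigma>) la (fst z) * mixed (Suc a - \<sigma>) b (k \<beta>) z))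
      + (\<Sum>\<sigma>\<le>b. real (b choose \<sigma>) * ((deriv01 ^^ \<sigma>) lb (snd z) * mixed a (Suc b - \<sigma>) (k \<beta>) z))
      + (\<Sum>\<gamma><n. \<Sum>\<sigma>\<le>b. real (b choose \<sigma>) * ((deriv01 ^^ \<sigma>) (c \<gamma>) (snd z) * mixed a (b - \<sigma>) (k \<gamma>) z)) = 0"
proof -
  let ?f = "\<lambda>z. la (fst z) * pdx (k \<beta>) z" and ?g = "\<lambda>z. lb (snd z) * pdxi (k \<beta>) z"
    and ?h = "\<lambda>\<gamma> z. c \<gamma> (snd z) * k \<gamma> z"
  have C: "Ctri (a + b) ?f" "Ctri (a + b) ?g" "\<And>\<gamma>. \<gamma> < n \<Longrightarrow> Ctri (a + b) (?h \<gamma>)"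
    using \<beta> by (auto intro!: Ctri_mult Ctri_fst Ctri_snd la lb c Ctri_Suc_pdx Ctri_Suc_pdxi k Ctri_SucD[OF k])
  have Cs: "Ctri (a + b) (\<lambda>z. \<Sum>\<gamma><n. ?h \<gamma> z)"
    using C(3) by (intro Ctri_sum) auto
  have "?f w + ?g w + (\<Sum>\<gamma><n. ?h \<gamma> w) = 0" if "w \<in> closure tri" for w
    using Ctri_continuous[OF Ctri_add[OF Ctri_add[OF C(1,2)] Cs]]
    by (rule eq_on_closure_tri) (auto simp: eq that)
  then have "mixed a b (\<lambda>z. ?f z + ?g z + (\<Sum>\<gamma><n. ?h \<gamma> z)) z = mixed a b (\<lambda>_. 0) z"
    using z by (intro mixed_cong)
  then have "mixed a b ?f z + mixed a b ?g z + (\<Sum>\<gamma><n. mixed a b (?h \<gamma>) z) = 0"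
    using mixed_sum[where I = "{..<n}" and f = ?h and a = a and b = b, OF _ z] C Cs z
    by (simp add: mixed_zero mixed_add Ctri_add)
  moreover have "mixed a b ?f z = (\<Sum>\<sigma>\<le>a. real (a choose \<sigma>) * ((deriv01 ^^ \<sigma>) la (fst z) * mixed (Suc a - \<sigma>) b (k \<beta>) z))"
  proof -
    have "mixed (a - \<sigma>) b (pdx (k \<beta>)) z = mixed (Suc (a - \<sigma>)) b (k \<beta>) z" for \<sigma>
      by (rule mixed_pdx[OF Ctri_mono[OF k[OF \<beta>]] z]) simp
    then show ?thesis
      using la z k[OF \<beta>] by (subst mixed_mult_fst) (auto intro!: Ctri_Suc_pdx sum.cong simp: Suc_diff_le)
  qed
  moreover have "mixed a b ?g z = (\<Sum>\<sigma>\<le>b. real (b choose \<sigma>) * ((deriv01 ^^ \<sigma>) lb (snd z) * mixed a (Suc b - \<sigma>) (k \<beta>) z))"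
    using lb z k[OF \<beta>]
    by (subst mixed_mult_snd)
       (auto intro!: Ctri_Suc_pdxi sum.cong simp: mixed_Suc_xi Suc_diff_le)
  moreover have "mixed a b (?h \<gamma>) z = (\<Sum>\<sigma>\<le>b. real (b choose \<sigma>) * ((deriv01 ^^ \<sigma>) (c \<gamma>) (snd z) * mixed a (b - \<sigma>) (k \<gamma>) z))"
    if "\<gamma> < n" for \<gamma>
    using c z k that by (intro mixed_mult_snd) (auto intro: Ctri_SucD)
  ultimately show ?thesis by simp
qed

lemma index_mult_mat_sum:
  assumes "A \<in> carrier_mat nr k" "B \<in> carrier_mat k nc" "i < nr" "j < nc"
  shows "(A * B) $$ (i, j) = (\<Sum>c<k. A $$ (i, c) * B $$ (c, j))"
  using assms by (simp add: scalar_prod_def atLeast0LessThan)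

lemma kernel_solution_entry:
  assumes sol: "kernel_solution n lam M K" and z: "(x, \<xi>) \<in> tri"
    and K: "K (x, \<xi>) \<in> carrier_mat n n" and ij: "\<alpha> < n" "\<beta> < n"
  shows "lam \<alpha> x * pdx (\<lambda>z. K z $$ (\<alpha>, \<beta>)) (x, \<xi>) + lam \<beta> \<xi> * pdxi (\<lambda>z. K z $$ (\<alpha>, \<beta>)) (x, \<xi>)
    + (\<Sum>\<gamma><n. Acoef n lam M \<xi> $$ (\<gamma>, \<beta>) * K (x, \<xi>) $$ (\<alpha>, \<gamma>)) = 0"
proof -
  have c: "mpdx K (x, \<xi>) \<in> carrier_mat n n" "mpdxi K (x, \<xi>) \<in> carrier_mat n n"
    using K by (simp_all add: mpdx_def mpdxi_def)
  have "Lam n lam x * mpdx K (x, \<xi>) + mpdxi K (x, \<xi>) * Lam n lam \<xi> + K (x, \<xi>) * Acoef n lam M \<xi> = 0\<^sub>m n n"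
    using sol z by (auto simp: kernel_solution_def Acoef_def)
  then have "(Lam n lam x * mpdx K (x, \<xi>) + mpdxi K (x, \<xi>) * Lam n lam \<xi> + K (x, \<xi>) * Acoef n lam M \<xi>) $$ (\<alpha>, \<beta>) = 0"
    using ij by simp
  moreover have "(K (x, \<xi>) * Acoef n lam M \<xi>) $$ (\<alpha>, \<beta>)
      = (\<Sum>\<gamma><n. Acoef n lam M \<xi> $$ (\<gamma>, \<beta>) * K (x, \<xi>) $$ (\<alpha>, \<gamma>))"
    by (subst index_mult_mat_sum[OF K Acoef_carrier ij]) (simp add: mult.commute)
  moreover have "(Lam n lam x * mpdx K (x, \<xi>)) $$ (\<alpha>, \<beta>) = lam \<alpha> x * mpdx K (x, \<xi>) $$ (\<alpha>, \<beta>)"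
    unfolding Lam_def mat_diag_mult_left[OF c(1)] using ij by simp
  moreover have "(mpdxi K (x, \<xi>) * Lam n lam \<xi>) $$ (\<alpha>, \<beta>) = lam \<beta> \<xi> * mpdxi K (x, \<xi>) $$ (\<alpha>, \<beta>)"
    unfolding Lam_def mat_diag_mult_right[OF c(2)] using ij by simp
  moreover have "mpdx K (x, \<xi>) $$ (\<alpha>, \<beta>) = pdx (\<lambda>z. K z $$ (\<alpha>, \<beta>)) (x, \<xi>)"
    "mpdxi K (x, \<xi>) $$ (\<alpha>, \<beta>) = pdxi (\<lambda>z. K z $$ (\<alpha>, \<beta>)) (x, \<xi>)"
    using K ij by (simp_all add: mpdx_def mpdxi_def)
  ultimately show ?thesis
    using ij c K Lam_carrier[of n lam x] Lam_carrier[of n lam \<xi>] Acoef_carrier[of n lam M \<xi>] by simp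
qed

lemma kernel_solution_diagonal:
  assumes sol: "kernel_solution n lam M K" and x: "x \<in> {0..1}"
    and K: "K (x, x) \<in> carrier_mat n n" and ij: "\<alpha> < n" "\<beta> < n" and ne: "lam \<alpha> x \<noteq> lam \<beta> x"
  shows "K (x, x) $$ (\<alpha>, \<beta>) = M0 n lam M x $$ (\<alpha>, \<beta>) / (lam \<alpha> x - lam \<beta> x)"
proof -
  have "M0 n lam M x = Lam n lam x * K (x, x) - K (x, x) * Lam n lam x"
    using sol x by (auto simp: kernel_solution_def)
  also have "\<dots> $$ (\<alpha>, \<beta>) = (lam \<alpha> x - lam \<beta> x) * K (x, x) $$ (\<alpha>, \<beta>)"
    unfolding Lam_def mat_diag_mult_left[OF K] mat_diag_mult_right[OF K]
    using ij by (simp add: algebra_simps)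
  finally show ?thesis using ne by simp
qed

section \<open>Entries of the right-hand side\<close>

lemma deriv01_iter_zero: "x \<in> {0..1} \<Longrightarrow> (deriv01 ^^ k) (\<lambda>_. 0) x = 0"
proof (induction k arbitrary: x)
  case (Suc k)
  have "deriv01 ((deriv01 ^^ k) (\<lambda>_. 0)) x = deriv01 (\<lambda>_. 0) x"
    using Suc by (intro deriv01_cong) auto
  also have "\<dots> = 0" using Suc.prems by (intro deriv01_eqI) auto
  finally show ?case by simp
qed simp

lemma Phibar_carrier: "Phibar n lam M N \<alpha> X \<in> carrier_mat N n"
  unfolding Phibar_def msum_def by (rule minus_carrier_mat) simp

text \<open>
  Row \<open>l\<close> written out: up to sign, these are the lower order terms of the kernel equation differentiated
  \<open>N - 1 - l\<close> times in \<open>x\<close> and \<open>l\<close> times in \<open>\<xi>\<close>.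
\<close>

lemma Phibar_index:
  assumes X: "\<And>j. X j \<in> carrier_mat (j + 1) n" and l: "l < N" and \<beta>: "\<beta> < n"
  shows "Phibar n lam M N \<alpha> X $$ (l, \<beta>) =
    - (\<Sum>\<sigma>=0..<N. \<Sum>\<gamma><n. (if \<sigma> \<le> l then real (l choose \<sigma>) * X (N - 1 - \<sigma>) $$ (l - \<sigma>, \<gamma>) else 0)
          * (deriv01 ^^ \<sigma>) (\<lambda>t. Acoef n lam M t $$ (\<gamma>, \<beta>)) 0)
    - (\<Sum>\<sigma>=1..<N. (deriv01 ^^ \<sigma>) (lam \<alpha>) 0 *
          (if l < N - \<sigma> then real ((N - 1 - l) choose \<sigma>) * X (N - \<sigma>) $$ (l, \<beta>) else 0))
    - (\<Sum>\<sigma>=1..<N. (if \<sigma> \<le> l then real (l choose \<sigma>) * X (N - \<sigma>) $$ (Suc (l - \<sigma>), \<beta>) else 0)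
          * (deriv01 ^^ \<sigma>) (lam \<beta>) 0)"
proof -
  have XR: "X (N - 1 - \<sigma>) \<in> carrier_mat (N - \<sigma>) n" if "\<sigma> < N" for \<sigma>
    using X[of "N - 1 - \<sigma>"] that by (simp add: Suc_diff_Suc)
  have XS: "X (N - \<sigma>) \<in> carrier_mat (N - \<sigma> + 1) n" for \<sigma> by (rule X)
  have R: "(Rmat N \<sigma> * X (N - 1 - \<sigma>) * (mderiv01 ^^ \<sigma>) (Acoef n lam M) 0) $$ (l, \<beta>) =
      (\<Sum>\<gamma><n. (if \<sigma> \<le> l then real (l choose \<sigma>) * X (N - 1 - \<sigma>) $$ (l - \<sigma>, \<gamma>) else 0)
          * (deriv01 ^^ \<sigma>) (\<lambda>t. Acoef n lam M t $$ (\<gamma>, \<beta>)) 0)" if "\<sigma> \<in> {0..<N}" for \<sigma>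
  proof -
    have \<sigma>: "\<sigma> < N" using that by simp
    have "(Rmat N \<sigma> * X (N - 1 - \<sigma>) * (mderiv01 ^^ \<sigma>) (Acoef n lam M) 0) $$ (l, \<beta>) =
      (\<Sum>\<gamma><n. (Rmat N \<sigma> * X (N - 1 - \<sigma>)) $$ (l, \<gamma>) * (mderiv01 ^^ \<sigma>) (Acoef n lam M) 0 $$ (\<gamma>, \<beta>))"
      by (rule index_mult_mat_sum[OF mult_carrier_mat[OF Rmat_carrier[OF \<sigma>] XR[OF \<sigma>]] mderiv01_iter(1)[OF Acoef_carrier] l \<beta>]) simp
    also have "\<dots> = (\<Sum>\<gamma><n. (if \<sigma> \<le> l then real (l choose \<sigma>) * X (N - 1 - \<sigma>) $$ (l - \<sigma>, \<gamma>) else 0)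
          * (deriv01 ^^ \<sigma>) (\<lambda>t. Acoef n lam M t $$ (\<gamma>, \<beta>)) 0)"
      using \<beta>
      by (intro sum.cong refl arg_cong2[where f = "(*)"] Rmat_mult_index[OF \<sigma> l XR[OF \<sigma>]]
          mderiv01_iter(2)[OF Acoef_carrier]) auto
    finally show ?thesis .
  qed
  have Sc: "((deriv01 ^^ \<sigma>) (lam \<alpha>) 0 \<cdot>\<^sub>m (Scheck N \<sigma> * X (N - \<sigma>))) $$ (l, \<beta>) =
      (deriv01 ^^ \<sigma>) (lam \<alpha>) 0 * (if l < N - \<sigma> then real ((N - 1 - l) choose \<sigma>) * X (N - \<sigma>) $$ (l, \<beta>) else 0)"
    if "\<sigma> \<in> {1..<N}" for \<sigma>
  proof -
    have \<sigma>: "\<sigma> < N" using that by simp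
    have "Scheck N \<sigma> * X (N - \<sigma>) \<in> carrier_mat N n"
      by (rule mult_carrier_mat[OF Scheck_carrier[OF \<sigma>] XS])
    note d = carrier_matD[OF this]
    show ?thesis
      by (subst index_smult_mat(1)) (simp_all only: d l \<beta> Scheck_mult_index[OF \<sigma> l XS \<beta>])
  qed
  have S: "(Smat N \<sigma> * X (N - \<sigma>) * (mderiv01 ^^ \<sigma>) (Lam n lam) 0) $$ (l, \<beta>) =
      (if \<sigma> \<le> l then real (l choose \<sigma>) * X (N - \<sigma>) $$ (Suc (l - \<sigma>), \<beta>) else 0)
          * (deriv01 ^^ \<sigma>) (lam \<beta>) 0"
    if "\<sigma> \<in> {1..<N}" for \<sigma>
  proof -
    have \<sigma>: "\<sigma> < N" using that by simp
    have d: "(mderiv01 ^^ \<sigma>) (Lam n lam) 0 $$ (\<gamma>, \<beta>) = (if \<gamma> = \<beta> then (deriv01 ^^ \<sigma>) (lam \<beta>) 0 else 0)"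
      if "\<gamma> < n" for \<gamma>
      using that \<beta> by (auto simp: mderiv01_iter(2)[OF Lam_carrier] Lam_index deriv01_iter_zero)
    have "(Smat N \<sigma> * X (N - \<sigma>) * (mderiv01 ^^ \<sigma>) (Lam n lam) 0) $$ (l, \<beta>) =
      (\<Sum>\<gamma><n. (Smat N \<sigma> * X (N - \<sigma>)) $$ (l, \<gamma>) * (mderiv01 ^^ \<sigma>) (Lam n lam) 0 $$ (\<gamma>, \<beta>))"
      by (rule index_mult_mat_sum[OF mult_carrier_mat[OF Smat_carrier[OF \<sigma>] XS] mderiv01_iter(1)[OF Lam_carrier] l \<beta>]) simp
    also have "\<dots> = (\<Sum>\<gamma><n. if \<gamma> = \<beta> then (Smat N \<sigma> * X (N - \<sigma>)) $$ (l, \<beta>) * (deriv01 ^^ \<sigma>) (lam \<beta>) 0 else 0)"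
      by (rule sum.cong) (auto simp: d)
    also have "\<dots> = (Smat N \<sigma> * X (N - \<sigma>)) $$ (l, \<beta>) * (deriv01 ^^ \<sigma>) (lam \<beta>) 0"
      using \<beta> by simp
    finally show ?thesis unfolding Smat_mult_index[OF \<sigma> l XS \<beta>] .
  qed
  have "Phibar n lam M N \<alpha> X $$ (l, \<beta>) =
    - (\<Sum>\<sigma>=0..<N. (Rmat N \<sigma> * X (N - 1 - \<sigma>) * (mderiv01 ^^ \<sigma>) (Acoef n lam M) 0) $$ (l, \<beta>))
    - (\<Sum>\<sigma>=1..<N. ((deriv01 ^^ \<sigma>) (lam \<alpha>) 0 \<cdot>\<^sub>m (Scheck N \<sigma> * X (N - \<sigma>))) $$ (l, \<beta>))
    - (\<Sum>\<sigma>=1..<N. (Smat N \<sigma> * X (N - \<sigma>) * (mderiv01 ^^ \<sigma>) (Lam n lam) 0) $$ (l, \<beta>))"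
    unfolding Phibar_def msum_def using l \<beta> by simp
  then show ?thesis
    by (simp only: R Sc S cong: sum.cong)
qed

lemma Frow_carrier: "Frow n lam M \<alpha> f x \<in> carrier_mat 1 n"
  by (simp add: Frow_def)

lemma Phi_index:
  assumes "\<beta> < n"
  shows "dim_vec (Phi n lam M f N \<alpha> \<beta> X) = N + 1"
    and "l < N \<Longrightarrow> Phi n lam M f N \<alpha> \<beta> X $ l = Phibar n lam M N \<alpha> X $$ (l, \<beta>)"
    and "Phi n lam M f N \<alpha> \<beta> X $ N = (deriv01 ^^ N) (\<lambda>t. Frow n lam M \<alpha> f t $$ (0, \<beta>)) 0"
proof -
  have F: "(mderiv01 ^^ N) (Frow n lam M \<alpha> f) 0 \<in> carrier_mat 1 n"
    by (rule mderiv01_iter(1)[OF Frow_carrier]) simp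
  note P = Phibar_carrier[of n lam M N \<alpha> X]
  show "dim_vec (Phi n lam M f N \<alpha> \<beta> X) = N + 1"
    using P F by (simp add: Phi_def append_rows_def)
  show "Phi n lam M f N \<alpha> \<beta> X $ l = Phibar n lam M N \<alpha> X $$ (l, \<beta>)" if "l < N"
    using P F that assms by (simp add: Phi_def append_rows_def)
  have "Phi n lam M f N \<alpha> \<beta> X $ N = (mderiv01 ^^ N) (Frow n lam M \<alpha> f) 0 $$ (0, \<beta>)"
    using P F assms by (simp add: Phi_def append_rows_def)
  then show "Phi n lam M f N \<alpha> \<beta> X $ N = (deriv01 ^^ N) (\<lambda>t. Frow n lam M \<alpha> f t $$ (0, \<beta>)) 0"
    using mderiv01_iter(2)[OF Frow_carrier, of 0 0 \<beta> n] assms by simp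
qed

text \<open>
  Leibniz sums end at the order of differentiation of their row, while the sums in \<open>\<Phi>\<close> have the same range
  for all rows; the second form also isolates the term of highest order.
\<close>

lemma sum_atMost_extend:
  fixes f :: "nat \<Rightarrow> real"
  assumes "a < N"
  shows "(\<Sum>\<sigma>\<le>a. f \<sigma>) = (\<Sum>\<sigma>=0..<N. if \<sigma> \<le> a then f \<sigma> else 0)"
    and "(\<Sum>\<sigma>\<le>a. f \<sigma>) = f 0 + (\<Sum>\<sigma>=1..<N. if \<sigma> \<le> a then f \<sigma> else 0)"
proof -
  show *: "(\<Sum>\<sigma>\<le>a. f \<sigma>) = (\<Sum>\<sigma>=0..<N. if \<sigma> \<le> a then f \<sigma> else 0)"
    using assms by (intro sum.mono_neutral_cong_left) auto
  show "(\<Sum>\<sigma>\<le>a. f \<sigma>) = f 0 + (\<Sum>\<sigma>=1..<N. if \<sigma> \<le> a then f \<sigma> else 0)"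
    unfolding * using assms by (subst sum.atLeast_Suc_lessThan) auto
qed

section \<open>Taylor coefficients of the kernel at the corner\<close>

theorem theorem4p1:
  fixes m p n r :: nat
    and lam :: "nat \<Rightarrow> real \<Rightarrow> real"
    and M :: "real \<Rightarrow> real mat"
    and K :: "real \<times> real \<Rightarrow> real mat"
  assumes "m \<ge> 1" and "p \<ge> 1" and "n = m + p"
    and "C01_mat n (r + 1) (Lam n lam)"
    and "C01_mat n (r + 1) M"
    and "\<And>x i j. x \<in> {0..1} \<Longrightarrow> i < j \<Longrightarrow> j < n \<Longrightarrow> lam i x < lam j x"
    and "\<And>x i. x \<in> {0..1} \<Longrightarrow> i < m \<Longrightarrow> lam i x < 0"
    and "\<And>x i. x \<in> {0..1} \<Longrightarrow> m \<le> i \<Longrightarrow> i < n \<Longrightarrow> 0 < lam i x"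
    and "Ctri_mat n (r + 1) K"
    and "kernel_solution n lam M K"
  shows "(\<forall>\<alpha><n. \<forall>\<beta><n. \<beta> \<noteq> \<alpha> \<longrightarrow>
            K (0, 0) $$ (\<alpha>, \<beta>) = M0 n lam M 0 $$ (\<alpha>, \<beta>) / (lam \<alpha> 0 - lam \<beta> 0)) \<and>
         (\<forall>\<alpha><n. \<forall>\<beta><n. \<forall>N\<in>{1..r + 1}.
            Jmat lam N \<alpha> \<beta> *\<^sub>v Dvec N (\<lambda>z. K z $$ (\<alpha>, \<beta>)) (0, 0) =
              Phi n lam M (\<lambda>x. K (x, 0) $$ (\<alpha>, \<alpha>)) N \<alpha> \<beta> (\<lambda>j. Drow n j K \<alpha> (0, 0)) \<and>
            invertible_mat (Jmat lam N \<alpha> \<beta>))"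
proof -
  have lam_C: "C01 (Suc r) (lam i)" if "i < n" for i
    using assms(4) that by (auto simp: C01_mat_def Lam_index dest!: spec[of _ i])
  have lam_nz: "lam i x \<noteq> 0" if "x \<in> {0..1}" "i < n" for i x
    using assms(7)[OF that(1), of i] assms(8)[OF that(1), of i] that(2) by (cases "i < m") auto
  have lam_ne: "lam i x \<noteq> lam j x" if "x \<in> {0..1}" "i < n" "j < n" "i \<noteq> j" for i j x
    using assms(6)[OF that(1), of i j] assms(6)[OF that(1), of j i] that by (cases i j rule: linorder_cases) auto
  have K_car: "K z \<in> carrier_mat n n" if "z \<in> closure tri" for z
    using assms(9) that by (simp add: Ctri_mat_def)
  have K_C: "Ctri (Suc r) (\<lambda>z. K z $$ (i, j))" if "i < n" "j < n" for i j
    using assms(9) that by (simp add: Ctri_mat_def)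
  have diag: "K (x, x) $$ (\<alpha>, \<beta>) = M0 n lam M x $$ (\<alpha>, \<beta>) / (lam \<alpha> x - lam \<beta> x)"
    if "x \<in> {0..1}" "\<alpha> < n" "\<beta> < n" "\<beta> \<noteq> \<alpha>" for x \<alpha> \<beta>
    using that by (intro kernel_solution_diagonal[OF assms(10)] K_car lam_ne) (auto simp: closure_tri)
  have zero: "(0, 0) \<in> closure tri" by (simp add: closure_tri)
  have "Jmat lam N \<alpha> \<beta> *\<^sub>v Dvec N (\<lambda>z. K z $$ (\<alpha>, \<beta>)) (0, 0) =
              Phi n lam M (\<lambda>x. K (x, 0) $$ (\<alpha>, \<alpha>)) N \<alpha> \<beta> (\<lambda>j. Drow n j K \<alpha> (0, 0))"
    (is "?J *\<^sub>v ?v = ?Phi")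
    if \<alpha>: "\<alpha> < n" and \<beta>: "\<beta> < n" and N: "N \<in> {1..r + 1}" for \<alpha> \<beta> N
  proof (rule eq_vecI)
    show dim: "dim_vec (?J *\<^sub>v ?v) = dim_vec ?Phi"
      using Phi_index(1)[OF \<beta>] by (simp add: Jmat_def)
    fix l assume "l < dim_vec ?Phi"
    then have l: "l < N \<or> l = N" using Phi_index(1)[OF \<beta>] by auto
    have v: "?v \<in> carrier_vec (N + 1)" "\<And>j. j \<le> N \<Longrightarrow> ?v $ j = mixed (N - j) j (\<lambda>z. K z $$ (\<alpha>, \<beta>)) (0, 0)"
      by (auto simp: Dvec_def pd_def mixed_def)
    from l show "(?J *\<^sub>v ?v) $ l = ?Phi $ l"
    proof
      assume l: "l < N"
      \<comment> \<open>Row \<open>l\<close> is the kernel equation differentiated \<open>a\<close> times in \<open>x\<close> and \<open>l\<close> times in \<open>\<xi>\<close>: order \<open>N - 1 \<le> r\<close>,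
        which is all that \<open>K\<close> and the coefficients allow.\<close>
      define a where "a = N - 1 - l"
      have al: "a + l \<le> r" "a < N" "Suc a = N - l" using l N by (auto simp: a_def)
      have X: "Drow n j K \<alpha> (0, 0) \<in> carrier_mat (j + 1) n" for j by (simp add: Drow_def)
      have X': "Drow n j K \<alpha> (0, 0) $$ (i, \<gamma>) = mixed (j - i) i (\<lambda>z. K z $$ (\<alpha>, \<gamma>)) (0, 0)"
        if "i \<le> j" "\<gamma> < n" for i j \<gamma> using that by (simp add: Drow_def pd_def mixed_def)
      have "(\<Sum>\<sigma>\<le>a. real (a choose \<sigma>) * ((deriv01 ^^ \<sigma>) (lam \<alpha>) 0 * mixed (Suc a - \<sigma>) l (\<lambda>z. K z $$ (\<alpha>, \<beta>)) (0, 0)))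
        + (\<Sum>\<sigma>\<le>l. real (l choose \<sigma>) * ((deriv01 ^^ \<sigma>) (lam \<beta>) 0 * mixed a (Suc l - \<sigma>) (\<lambda>z. K z $$ (\<alpha>, \<beta>)) (0, 0)))
        + (\<Sum>\<gamma><n. \<Sum>\<sigma>\<le>l. real (l choose \<sigma>) * ((deriv01 ^^ \<sigma>) (\<lambda>t. Acoef n lam M t $$ (\<gamma>, \<beta>)) 0
            * mixed a (l - \<sigma>) (\<lambda>z. K z $$ (\<alpha>, \<gamma>)) (0, 0))) = 0"
        (is "?S1 + ?S2 + ?S3 = 0")
      proof (rule differentiated_kernel_equation[where z = "(0, 0)" and k = "\<lambda>\<gamma> z. K z $$ (\<alpha>, \<gamma>)",
            unfolded fst_conv snd_conv])
        show "C01 (a + l) (lam \<alpha>)" "C01 (a + l) (lam \<beta>)"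
          using C01_mono[OF lam_C, of _ "a + l"] \<alpha> \<beta> al by auto
        show "C01 (a + l) (\<lambda>t. Acoef n lam M t $$ (\<gamma>, \<beta>))" if "\<gamma> < n" for \<gamma>
          using C01_Acoef[of n r M lam \<gamma> \<beta>] assms(5) lam_C lam_nz that \<beta> al(1) by (auto intro: C01_mono)
        show "Ctri (Suc (a + l)) (\<lambda>z. K z $$ (\<alpha>, \<gamma>))" if "\<gamma> < n" for \<gamma>
          using Ctri_mono[OF K_C[OF \<alpha> that]] al(1) by simp
        show "lam \<alpha> (fst z) * pdx (\<lambda>z. K z $$ (\<alpha>, \<beta>)) z + lam \<beta> (snd z) * pdxi (\<lambda>z. K z $$ (\<alpha>, \<beta>)) z
            + (\<Sum>\<gamma><n. Acoef n lam M (snd z) $$ (\<gamma>, \<beta>) * K z $$ (\<alpha>, \<gamma>)) = 0" if "z \<in> tri" for z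
          using kernel_solution_entry[OF assms(10), of "fst z" "snd z"] that K_car \<alpha> \<beta> tri_subset_closure by simp
      qed (use \<beta> zero in auto)
      moreover have "?S1 = lam \<alpha> 0 * ?v $ l + (\<Sum>\<sigma>=1..<N. (deriv01 ^^ \<sigma>) (lam \<alpha>) 0 *
          (if l < N - \<sigma> then real ((N - 1 - l) choose \<sigma>) * Drow n (N - \<sigma>) K \<alpha> (0, 0) $$ (l, \<beta>) else 0))"
        unfolding sum_atMost_extend(2)[OF al(2)]
      proof (intro arg_cong2[where f = "(+)"] sum.cong refl)
        show "real (a choose 0) * ((deriv01 ^^ 0) (lam \<alpha>) 0 * mixed (Suc a - 0) l (\<lambda>z. K z $$ (\<alpha>, \<beta>)) (0, 0)) = lam \<alpha> 0 * ?v $ l"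
          using v(2)[of l] l al(3) by simp
        fix \<sigma>
        have "Suc a - \<sigma> = N - \<sigma> - l" "\<sigma> \<le> a \<longleftrightarrow> l < N - \<sigma>" using al(3) l by auto
        then show "(if \<sigma> \<le> a then real (a choose \<sigma>) * ((deriv01 ^^ \<sigma>) (lam \<alpha>) 0 * mixed (Suc a - \<sigma>) l (\<lambda>z. K z $$ (\<alpha>, \<beta>)) (0, 0)) else 0)
          = (deriv01 ^^ \<sigma>) (lam \<alpha>) 0 *
          (if l < N - \<sigma> then real ((N - 1 - l) choose \<sigma>) * Drow n (N - \<sigma>) K \<alpha> (0, 0) $$ (l, \<beta>) else 0)"
          using X'[of l "N - \<sigma>" \<beta>] \<beta> by (simp add: a_def)
      qed
      moreover have "?S2 = lam \<beta> 0 * ?v $ Suc l + (\<Sum>\<sigma>=1..<N.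
          (if \<sigma> \<le> l then real (l choose \<sigma>) * Drow n (N - \<sigma>) K \<alpha> (0, 0) $$ (Suc (l - \<sigma>), \<beta>) else 0)
          * (deriv01 ^^ \<sigma>) (lam \<beta>) 0)"
        unfolding sum_atMost_extend(2)[OF l]
      proof (intro arg_cong2[where f = "(+)"] sum.cong refl)
        show "real (l choose 0) * ((deriv01 ^^ 0) (lam \<beta>) 0 * mixed a (Suc l - 0) (\<lambda>z. K z $$ (\<alpha>, \<beta>)) (0, 0)) = lam \<beta> 0 * ?v $ Suc l"
          using v(2)[of "Suc l"] l by (simp add: a_def)
        fix \<sigma>
        have "N - \<sigma> - Suc (l - \<sigma>) = a" "Suc l - \<sigma> = Suc (l - \<sigma>)" "Suc (l - \<sigma>) \<le> N - \<sigma>" if "\<sigma> \<le> l"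
          using that l by (auto simp: a_def)
        then show "(if \<sigma> \<le> l then real (l choose \<sigma>) * ((deriv01 ^^ \<sigma>) (lam \<beta>) 0 * mixed a (Suc l - \<sigma>) (\<lambda>z. K z $$ (\<alpha>, \<beta>)) (0, 0)) else 0)
          = (if \<sigma> \<le> l then real (l choose \<sigma>) * Drow n (N - \<sigma>) K \<alpha> (0, 0) $$ (Suc (l - \<sigma>), \<beta>) else 0)
          * (deriv01 ^^ \<sigma>) (lam \<beta>) 0"
          using X'[of "Suc (l - \<sigma>)" "N - \<sigma>" \<beta>] \<beta> by simp
      qed
      moreover have "?S3 = (\<Sum>\<sigma>=0..<N. \<Sum>\<gamma><n.
          (if \<sigma> \<le> l then real (l choose \<sigma>) * Drow n (N - 1 - \<sigma>) K \<alpha> (0, 0) $$ (l - \<sigma>, \<gamma>) else 0)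
          * (deriv01 ^^ \<sigma>) (\<lambda>t. Acoef n lam M t $$ (\<gamma>, \<beta>)) 0)"
        unfolding sum_atMost_extend(1)[OF l]
      proof (subst sum.swap, intro sum.cong refl)
        fix \<sigma> \<gamma> assume "\<gamma> \<in> {..<n}"
        moreover have "N - 1 - \<sigma> - (l - \<sigma>) = a" "l - \<sigma> \<le> N - 1 - \<sigma>" if "\<sigma> \<le> l"
          using that l by (auto simp: a_def)
        ultimately show "(if \<sigma> \<le> l then real (l choose \<sigma>) * ((deriv01 ^^ \<sigma>) (\<lambda>t. Acoef n lam M t $$ (\<gamma>, \<beta>)) 0
            * mixed a (l - \<sigma>) (\<lambda>z. K z $$ (\<alpha>, \<gamma>)) (0, 0)) else 0)
          = (if \<sigma> \<le> l then real (l choose \<sigma>) * Drow n (N - 1 - \<sigma>) K \<alpha> (0, 0) $$ (l - \<sigma>, \<gamma>) else 0)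
          * (deriv01 ^^ \<sigma>) (\<lambda>t. Acoef n lam M t $$ (\<gamma>, \<beta>)) 0"
          using X'[of "l - \<sigma>" "N - 1 - \<sigma>" \<gamma>] by simp
      qed
      ultimately show "(?J *\<^sub>v ?v) $ l = ?Phi $ l"
        unfolding Jmat_mult_row[OF v(1) l] Phi_index(2)[OF \<beta> l] Phibar_index[OF X l \<beta>] by linarith
    next
      assume l: "l = N"
      show "(?J *\<^sub>v ?v) $ l = ?Phi $ l"
      \<comment> \<open>The last row compares \<open>N\<close>-th derivatives along a side: the base \<open>\<xi> = 0\<close> if \<open>\<beta> = \<alpha>\<close>, and the diagonal,
        where the boundary condition determines the entry, if \<open>\<beta> \<noteq> \<alpha>\<close>.\<close>
      proof (cases "\<beta> = \<alpha>")
        case True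
        have "(deriv01 ^^ N) (\<lambda>t. Frow n lam M \<alpha> (\<lambda>x. K (x, 0) $$ (\<alpha>, \<alpha>)) t $$ (0, \<beta>)) 0
            = (deriv01 ^^ N) (\<lambda>t. K (t, 0) $$ (\<alpha>, \<alpha>)) 0"
          using True \<beta> by (intro deriv01_iter_cong) (auto simp: Frow_def)
        also have "\<dots> = mixed N 0 (\<lambda>z. K z $$ (\<alpha>, \<alpha>)) (0, 0)"
          using Ctri_mono[OF K_C[OF \<alpha> \<alpha>], of N] N by (subst deriv01_iter_base[where h = "\<lambda>z. K z $$ (\<alpha>, \<alpha>)"]) auto
        also have "\<dots> = ?v $ 0" using v(2)[of 0] True by simp
        finally show ?thesis
          unfolding l Jmat_mult_last_row[OF v(1)] Phi_index(3)[OF \<beta>] using True by simp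
      next
        case False
        have "(deriv01 ^^ N) (\<lambda>t. Frow n lam M \<alpha> (\<lambda>x. K (x, 0) $$ (\<alpha>, \<alpha>)) t $$ (0, \<beta>)) 0
            = (deriv01 ^^ N) (\<lambda>t. K (t, t) $$ (\<alpha>, \<beta>)) 0"
          using False \<alpha> \<beta> diag by (intro deriv01_iter_cong) (auto simp: Frow_def)
        also have "\<dots> = (\<Sum>i\<le>N. real (N choose i) * mixed (N - i) i (\<lambda>z. K z $$ (\<alpha>, \<beta>)) (0, 0))"
          using Ctri_mono[OF K_C[OF \<alpha> \<beta>], of N] N by (intro deriv01_iter_diagonal) auto
        also have "\<dots> = (\<Sum>i\<le>N. real (N choose i) * ?v $ i)"
          by (intro sum.cong refl) (simp add: v(2))
        finally show ?thesis
          unfolding l Jmat_mult_last_row[OF v(1)] Phi_index(3)[OF \<beta>] using False by simp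
      qed
    qed
  qed
  moreover have "invertible_mat (Jmat lam N \<alpha> \<beta>)" if "\<alpha> < n" "\<beta> < n" for \<alpha> \<beta> N
    using that lam_nz[of 0] lam_ne[of 0 \<alpha> \<beta>] by (intro invertible_Jmat) auto
  ultimately show ?thesis
    using diag[of 0] by auto
qed

end
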